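(* Let $\mathcal M$ be a potentialist system of $L$-structures which contains an infinite world, and let $T=\mathrm{Th}(\mathcal M)$. Assume that $T$ is $\aleph_0$-categorical and has quantifier elimination. Then $\mathcal M$ is bitotally bisimilar to a potentialist system which contains exactly one infinite world, which is countable, and which has no self-embeddings (in the system) except the identity. In particular, when $T$ has no finite models, $\mathcal M$ is bitotally bisimilar to a singleton system consisting of a countable world with just the identity embedding.
   Context: $L$ is a first-order, finitary, non-modal language. A potentialist system is a collection (possibly a proper class) of $L$-structures, called worlds, together with a collection of embeddings between them, containing the identity embeddings and all compositions of embeddings. "$\pi\colon M\to M'$ in $\mathcal M$" means that $\pi$ is one of the embeddings of $\mathcal M$. $\mathrm{Th}(\mathcal M)$ is the set of finitary non-modal first-order $L$-sentences which hold in all worlds of $\mathcal M$. A theory is $\aleph_0$-categorical if it has, up to isomorphism, exactly one model of cardinality $\aleph_0$. A bisimulation between potentialist systems $\mathcal M$ and $\mathcal N$ is a non-empty relation $\sim$ matching pairs $(M,\overline a)$ with pairs $(N,\overline b)$, where $M\in\mathcal M$, $N\in\mathcal N$ and $\overline a,\overline b$ are finite tuples of the same length from $M,N$ respectively, such that whenever $(M,\overline a)\sim(N,\overline b)$: (B1) $\overline a\mapsto\overline b$ is a partial isomorphism, i.e. $\overline a$ in $M$ and $\overline b$ in $N$ satisfy the same atomic formulas; (B2) for any $c\in M$ there is $d\in N$ with $(M,\overline a c)\sim(N,\overline b d)$, and vice versa; (B3) for any $\pi\colon M\to M'$ in $\mathcal M$ there is $\rho\colon N\to N'$ in $\mathcal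 N$ with $(M',\pi(\overline a))\sim(N',\rho(\overline b))$, and vice versa. Here $\overline a c$ is $\overline a$ with $c$ appended, and $\pi(\overline a)$ is taken componentwise. The bisimulation is bitotal if every pair from $\mathcal M$ is related to some pair from $\mathcal N$ and every pair from $\mathcal N$ is related to some pair from $\mathcal M$. Two systems are bitotally bisimilar if there is a bitotal bisimulation between them.
   Formalization: The language L is assumed countable; without this the claim fails, e.g. for continuum many constants with two infinite worlds, one with all constants equal and one with all distinct, and only identity embeddings. *)

theory Defs
  imports Complex_Main "HOL-Library.FuncSet" "HOL-Library.Countable_Set"
begin

section \<open>First-order languages, formulas and structures\<close>

text \<open>The symbols are sets rather than whole types, so that a language may lack function symbols or
  relation symbols. Constants are function symbols of arity \<open>0\<close>.\<close>

record ('f, 'r) language =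
  funs :: "'f set"
  rels :: "'r set"
  farity :: "'f \<Rightarrow> nat"
  rarity :: "'r \<Rightarrow> nat"

definition countable_language :: "('f, 'r) language \<Rightarrow> bool" where
  "countable_language L \<longleftrightarrow> countable (funs L) \<and> countable (rels L)"

datatype 'f tm = Var nat | Fn 'f "'f tm list"

datatype ('f, 'r) fm =
    Bot
  | Eq "'f tm" "'f tm"
  | Rel 'r "'f tm list"
  | Imp "('f, 'r) fm" "('f, 'r) fm"
  | All nat "('f, 'r) fm"

fun wf_tm :: "('f, 'r) language \<Rightarrow> 'f tm \<Rightarrow> bool" where
  "wf_tm L (Var x) \<longleftrightarrow> True"
| "wf_tm L (Fn f ts) \<longleftrightarrow> f \<in> funs L \<and> length ts = farity L f \<and> (\<forall>t\<in>set ts. wf_tm L t)"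

fun wf_fm :: "('f, 'r) language \<Rightarrow> ('f, 'r) fm \<Rightarrow> bool" where
  "wf_fm L Bot \<longleftrightarrow> True"
| "wf_fm L (Eq s t) \<longleftrightarrow> wf_tm L s \<and> wf_tm L t"
| "wf_fm L (Rel r ts) \<longleftrightarrow> r \<in> rels L \<and> length ts = rarity L r \<and> (\<forall>t\<in>set ts. wf_tm L t)"
| "wf_fm L (Imp \<phi> \<psi>) \<longleftrightarrow> wf_fm L \<phi> \<and> wf_fm L \<psi>"
| "wf_fm L (All x \<phi>) \<longleftrightarrow> wf_fm L \<phi>"

fun tm_vars :: "'f tm \<Rightarrow> nat set" where
  "tm_vars (Var x) = {x}"
| "tm_vars (Fn f ts) = (\<Union>t\<in>set ts. tm_vars t)"

fun free_vars :: "('f, 'r) fm \<Rightarrow> nat set" where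
  "free_vars Bot = {}"
| "free_vars (Eq s t) = tm_vars s \<union> tm_vars t"
| "free_vars (Rel r ts) = (\<Union>t\<in>set ts. tm_vars t)"
| "free_vars (Imp \<phi> \<psi>) = free_vars \<phi> \<union> free_vars \<psi>"
| "free_vars (All x \<phi>) = free_vars \<phi> - {x}"

fun atomic :: "('f, 'r) fm \<Rightarrow> bool" where
  "atomic (Eq s t) \<longleftrightarrow> True"
| "atomic (Rel r ts) \<longleftrightarrow> True"
| "atomic _ \<longleftrightarrow> False"

fun qfree :: "('f, 'r) fm \<Rightarrow> bool" where
  "qfree (Imp \<phi> \<psi>) \<longleftrightarrow> qfree \<phi> \<and> qfree \<psi>"
| "qfree (All x \<phi>) \<longleftrightarrow> False"
| "qfree _ \<longleftrightarrow> True"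

record ('f, 'r, 'a) struct =
  carrier :: "'a set"
  fint :: "'f \<Rightarrow> 'a list \<Rightarrow> 'a"
  rint :: "'r \<Rightarrow> 'a list \<Rightarrow> bool"

text \<open>Interpretations take a fixed value on arguments that are not meaningful (\<open>undefined\<close> or
  \<open>False\<close>), so that equality of records is equality of \<open>L\<close>-structures and worlds can be counted.\<close>

definition is_structure :: "('f, 'r) language \<Rightarrow> ('f, 'r, 'a) struct \<Rightarrow> bool" where
  "is_structure L M \<longleftrightarrow>
     carrier M \<noteq> {} \<and>
     (\<forall>f xs. if f \<in> funs L \<and> length xs = farity L f \<and> set xs \<subseteq> carrier M
             then fint M f xs \<in> carrier M else fint M f xs = undefined) \<and>
     (\<forall>r xs. rint M r xs \<longrightarrow> r \<in> rels L \<and> length xs = rarity L r \<and> set xs \<subseteq> carrier M)"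

fun tm_val :: "('f, 'r, 'a) struct \<Rightarrow> (nat \<Rightarrow> 'a) \<Rightarrow> 'f tm \<Rightarrow> 'a" where
  "tm_val M e (Var x) = e x"
| "tm_val M e (Fn f ts) = fint M f (map (tm_val M e) ts)"

fun sat :: "('f, 'r, 'a) struct \<Rightarrow> (nat \<Rightarrow> 'a) \<Rightarrow> ('f, 'r) fm \<Rightarrow> bool" where
  "sat M e Bot \<longleftrightarrow> False"
| "sat M e (Eq s t) \<longleftrightarrow> tm_val M e s = tm_val M e t"
| "sat M e (Rel r ts) \<longleftrightarrow> rint M r (map (tm_val M e) ts)"
| "sat M e (Imp \<phi> \<psi>) \<longleftrightarrow> (sat M e \<phi> \<longrightarrow> sat M e \<psi>)"
| "sat M e (All x \<phi>) \<longleftrightarrow> (\<forall>a\<in>carrier M. sat M (e(x := a)) \<phi>)"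

definition valid_in :: "('f, 'r, 'a) struct \<Rightarrow> ('f, 'r) fm \<Rightarrow> bool" where
  "valid_in M \<phi> \<longleftrightarrow> (\<forall>e. range e \<subseteq> carrier M \<longrightarrow> sat M e \<phi>)"

definition is_model ::
  "('f, 'r) language \<Rightarrow> ('f, 'r) fm set \<Rightarrow> ('f, 'r, 'a) struct \<Rightarrow> bool" where
  "is_model L T M \<longleftrightarrow> is_structure L M \<and> (\<forall>\<phi>\<in>T. valid_in M \<phi>)"

text \<open>Embeddings are extensional functions, so the identity of \<open>M\<close> is \<open>\<lambda>x\<in>carrier M. x\<close>.\<close>

definition is_embedding ::
  "('f, 'r) language \<Rightarrow> ('f, 'r, 'a) struct \<Rightarrow> ('f, 'r, 'b) struct \<Rightarrow> ('a \<Rightarrow> 'b) \<Rightarrow> bool" where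
  "is_embedding L M N \<pi> \<longleftrightarrow>
     \<pi> \<in> carrier M \<rightarrow>\<^sub>E carrier N \<and> inj_on \<pi> (carrier M) \<and>
     (\<forall>f\<in>funs L. \<forall>xs. length xs = farity L f \<and> set xs \<subseteq> carrier M \<longrightarrow>
        \<pi> (fint M f xs) = fint N f (map \<pi> xs)) \<and>
     (\<forall>r\<in>rels L. \<forall>xs. length xs = rarity L r \<and> set xs \<subseteq> carrier M \<longrightarrow>
        (rint M r xs \<longleftrightarrow> rint N r (map \<pi> xs)))"

definition isomorphic ::
  "('f, 'r) language \<Rightarrow> ('f, 'r, 'a) struct \<Rightarrow> ('f, 'r, 'b) struct \<Rightarrow> bool" where
  "isomorphic L M N \<longleftrightarrow> (\<exists>\<pi>. is_embedding L M N \<pi> \<and> \<pi> ` carrier M = carrier N)"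


section \<open>Properties of theories\<close>

text \<open>A definition cannot quantify over the carrier types of models, so a sufficient type is chosen
  in each case. Every structure of cardinality \<open>\<aleph>\<^sub>0\<close>, and every finite one, is isomorphic to a
  structure whose carrier is a set of natural numbers.\<close>

definition aleph0_categorical :: "('f, 'r) language \<Rightarrow> ('f, 'r) fm set \<Rightarrow> bool" where
  "aleph0_categorical L T \<longleftrightarrow>
     (\<exists>M :: ('f, 'r, nat) struct. is_model L T M \<and> infinite (carrier M)) \<and>
     (\<forall>(M :: ('f, 'r, nat) struct) (N :: ('f, 'r, nat) struct).
        is_model L T M \<and> infinite (carrier M) \<and> is_model L T N \<and> infinite (carrier N) \<longrightarrow>
        isomorphic L M N)"

definition no_finite_models :: "('f, 'r) language \<Rightarrow> ('f, 'r) fm set \<Rightarrow> bool" where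
  "no_finite_models L T \<longleftrightarrow>
     (\<forall>M :: ('f, 'r, nat) struct. is_model L T M \<longrightarrow> infinite (carrier M))"

text \<open>Every formula is equivalent modulo \<open>T\<close> to a quantifier-free one. The models range over
  structures whose elements are taken from the type of formulas: this type is infinite and at least
  as large as the set of symbols, so by the downward Loewenheim-Skolem theorem an equivalence that
  holds in all these models holds in all models of \<open>T\<close>. The free variables of \<open>\<psi>\<close> are not
  restricted; if \<open>\<phi>\<close> has a free variable, superfluous variables of \<open>\<psi>\<close> can be replaced by it.\<close>

definition has_qe :: "('f, 'r) language \<Rightarrow> ('f, 'r) fm set \<Rightarrow> bool" where
  "has_qe L T \<longleftrightarrow>
     (\<forall>\<phi>. wf_fm L \<phi> \<longrightarrow>
        (\<exists>\<psi>. wf_fm L \<psi> \<and> qfree \<psi> \<and>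
           (\<forall>(M :: ('f, 'r, ('f, 'r) fm) struct) e.
              is_model L T M \<and> range e \<subseteq> carrier M \<longrightarrow> (sat M e \<phi> \<longleftrightarrow> sat M e \<psi>))))"


section \<open>Potentialist systems and bisimulations\<close>

text \<open>The triple \<open>(M, \<pi>, M')\<close> in \<open>embs \<M>\<close> stands for the embedding \<open>\<pi>\<close> from \<open>M\<close> to \<open>M'\<close>.\<close>

record ('f, 'r, 'a) system =
  worlds :: "('f, 'r, 'a) struct set"
  embs :: "(('f, 'r, 'a) struct \<times> ('a \<Rightarrow> 'a) \<times> ('f, 'r, 'a) struct) set"

definition potentialist_system :: "('f, 'r) language \<Rightarrow> ('f, 'r, 'a) system \<Rightarrow> bool" where
  "potentialist_system L \<M> \<longleftrightarrow>
     (\<forall>M\<in>worlds \<M>. is_structure L M) \<and>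
     (\<forall>M \<pi> M'. (M, \<pi>, M') \<in> embs \<M> \<longrightarrow>
        M \<in> worlds \<M> \<and> M' \<in> worlds \<M> \<and> is_embedding L M M' \<pi>) \<and>
     (\<forall>M\<in>worlds \<M>. (M, \<lambda>x\<in>carrier M. x, M) \<in> embs \<M>) \<and>
     (\<forall>M \<pi> M' \<rho> M''. (M, \<pi>, M') \<in> embs \<M> \<and> (M', \<rho>, M'') \<in> embs \<M> \<longrightarrow>
        (M, compose (carrier M) \<rho> \<pi>, M'') \<in> embs \<M>)"

definition theory_of :: "('f, 'r) language \<Rightarrow> ('f, 'r, 'a) system \<Rightarrow> ('f, 'r) fm set" where
  "theory_of L \<M> = {\<phi>. wf_fm L \<phi> \<and> free_vars \<phi> = {} \<and> (\<forall>M\<in>worlds \<M>. valid_in M \<phi>)}"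

definition pairs :: "('f, 'r, 'a) system \<Rightarrow> (('f, 'r, 'a) struct \<times> 'a list) set" where
  "pairs \<M> = {(M, as). M \<in> worlds \<M> \<and> set as \<subseteq> carrier M}"

definition partial_isomorphism ::
  "('f, 'r) language \<Rightarrow> ('f, 'r, 'a) struct \<Rightarrow> 'a list \<Rightarrow> ('f, 'r, 'b) struct \<Rightarrow> 'b list \<Rightarrow> bool"
where
  "partial_isomorphism L M as N bs \<longleftrightarrow>
     (\<forall>\<phi>. wf_fm L \<phi> \<and> atomic \<phi> \<and> free_vars \<phi> \<subseteq> {..<length as} \<longrightarrow>
        (sat M (\<lambda>i. as ! i) \<phi> \<longleftrightarrow> sat N (\<lambda>i. bs ! i) \<phi>))"

definition bisimulation ::
  "('f, 'r) language \<Rightarrow> ('f, 'r, 'a) system \<Rightarrow> ('f, 'r, 'b) system \<Rightarrow>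
   ((('f, 'r, 'a) struct \<times> 'a list) \<times> (('f, 'r, 'b) struct \<times> 'b list)) set \<Rightarrow> bool"
where
  "bisimulation L \<M> \<N> R \<longleftrightarrow>
     R \<noteq> {} \<and> R \<subseteq> pairs \<M> \<times> pairs \<N> \<and>
     (\<forall>M as N bs. ((M, as), (N, bs)) \<in> R \<longrightarrow>
        length as = length bs \<and>
        partial_isomorphism L M as N bs \<and>
        (\<forall>c\<in>carrier M. \<exists>d\<in>carrier N. ((M, as @ [c]), (N, bs @ [d])) \<in> R) \<and>
        (\<forall>d\<in>carrier N. \<exists>c\<in>carrier M. ((M, as @ [c]), (N, bs @ [d])) \<in> R) \<and>
        (\<forall>\<pi> M'. (M, \<pi>, M') \<in> embs \<M> \<longrightarrow>
           (\<exists>\<rho> N'. (N, \<rho>, N') \<in> embs \<N> \<and> ((M', map \<pi> as), (N', map \<rho> bs)) \<in> R)) \<and>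
        (\<forall>\<rho> N'. (N, \<rho>, N') \<in> embs \<N> \<longrightarrow>
           (\<exists>\<pi> M'. (M, \<pi>, M') \<in> embs \<M> \<and> ((M', map \<pi> as), (N', map \<rho> bs)) \<in> R)))"

definition bitotally_bisimilar ::
  "('f, 'r) language \<Rightarrow> ('f, 'r, 'a) system \<Rightarrow> ('f, 'r, 'b) system \<Rightarrow> bool" where
  "bitotally_bisimilar L \<M> \<N> \<longleftrightarrow>
     (\<exists>R. bisimulation L \<M> \<N> R \<and>
        (\<forall>p\<in>pairs \<M>. \<exists>q\<in>pairs \<N>. (p, q) \<in> R) \<and>
        (\<forall>q\<in>pairs \<N>. \<exists>p\<in>pairs \<M>. (p, q) \<in> R))"

end

theory Submission
  imports Defs
begin

text \<open>All infinite worlds look alike to the modal language. They are models of the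
  \<open>\<aleph>\<^sub>0\<close>-categorical theory \<open>T\<close>, so each of them contains, around any countable set of its elements,
  an elementary copy of one countable model \<open>W\<close> (\<open>countable_elementary_cover\<close>, from downward
  Loewenheim-Skolem and categoricity); and the embeddings between them are elementary, because
  quantifier elimination makes \<open>T\<close> model complete on infinite models
  (\<open>embedding_elementary_map\<close>). A move along an embedding of infinite worlds therefore leaves the type
  of a tuple unchanged, and can be answered by staying in \<open>W\<close>. Hence all infinite worlds can be
  collapsed to the single world \<open>W\<close>, with the identity as its only embedding. The finite worlds
  are kept with their embeddings, and an embedding of a finite world into an infinite world is
  replaced by the embeddings into \<open>W\<close> that realize the same types. A finite world is matched with
  itself, and a tuple of an infinite world with the tuples of \<open>W\<close> of the same type. No embedding
  leads from an infinite world to a finite one, so these are all the cases.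

  The extension property of a bisimulation requires in addition that \<open>W\<close> be homogeneous: tuples of the
  same type must have the same one-element extensions (\<open>categorical_homogeneous\<close>). An ultrapower of \<open>W\<close> over the natural numbers is countably saturated, hence homogeneous, and a
  countable elementary substructure of it that is closed under a choice of homogeneity
  witnesses is again homogeneous. By categoricity this substructure is isomorphic to \<open>W\<close>.\<close>


section \<open>Assignments and finite tuples\<close>

lemma finite_tm_vars: "finite (tm_vars t)"
  by (induction t) auto

lemma finite_free_vars: "finite (free_vars \<phi>)"
  by (induction \<phi>) (auto simp: finite_tm_vars)

lemma tm_val_cong:
  "(\<And>x. x \<in> tm_vars t \<Longrightarrow> e x = e' x) \<Longrightarrow> tm_val M e t = tm_val M e' t"
proof (induction t)
  case (Fn f ts)
  then have "map (tm_val M e) ts = map (tm_val M e') ts" by auto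
  then show ?case by (metis tm_val.simps(2))
qed simp

lemma sat_cong:
  "(\<And>x. x \<in> free_vars \<phi> \<Longrightarrow> e x = e' x) \<Longrightarrow> sat M e \<phi> \<longleftrightarrow> sat M e' \<phi>"
proof (induction \<phi> arbitrary: e e')
  case (Eq s t)
  have "tm_val M e s = tm_val M e' s" "tm_val M e t = tm_val M e' t"
    by (rule tm_val_cong, simp add: Eq)+
  then show ?case by simp
next
  case (Rel r ts)
  have "tm_val M e t = tm_val M e' t" if "t \<in> set ts" for t
    using that by (intro tm_val_cong Rel) auto
  then have "map (tm_val M e) ts = map (tm_val M e') ts" by simp
  then show ?case by (metis sat.simps(3))
next
  case (Imp \<phi> \<psi>)
  have "sat M e \<phi> \<longleftrightarrow> sat M e' \<phi>" "sat M e \<psi> \<longleftrightarrow> sat M e' \<psi>"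
    by (rule Imp.IH, simp add: Imp.prems)+
  then show ?case by simp
next
  case (All x \<phi>)
  have "sat M (e(x := a)) \<phi> \<longleftrightarrow> sat M (e'(x := a)) \<phi>" for a
    using All.prems by (intro All.IH) auto
  then show ?case by simp
qed simp

text \<open>A list indexed beyond its length need not give elements of the structure. The padded
  assignment does, so that statements about all assignments into a structure apply to tuples.\<close>

definition pad :: "('f, 'r, 'a) struct \<Rightarrow> 'a list \<Rightarrow> nat \<Rightarrow> 'a" where
  "pad M as i = (if i < length as then as ! i else (SOME x. x \<in> carrier M))"

lemma range_pad:
  assumes "is_structure L M" and "set as \<subseteq> carrier M"
  shows "range (pad M as) \<subseteq> carrier M"
proof -
  have "(SOME x. x \<in> carrier M) \<in> carrier M"
    using assms(1) by (simp add: is_structure_def some_in_eq)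
  then show ?thesis using assms(2) by (auto simp: pad_def)
qed

lemma sat_pad:
  "free_vars \<phi> \<subseteq> {..<length as} \<Longrightarrow> sat M (pad N as) \<phi> \<longleftrightarrow> sat M (\<lambda>i. as ! i) \<phi>"
  by (rule sat_cong) (auto simp: pad_def)

definition same_type ::
  "('f, 'r) language \<Rightarrow> ('f, 'r, 'a) struct \<Rightarrow> 'a list \<Rightarrow> ('f, 'r, 'b) struct \<Rightarrow> 'b list \<Rightarrow> bool"
where
  "same_type L M as N bs \<longleftrightarrow> length as = length bs \<and>
     (\<forall>\<phi>. wf_fm L \<phi> \<and> free_vars \<phi> \<subseteq> {..<length as} \<longrightarrow>
        (sat M (\<lambda>i. as ! i) \<phi> \<longleftrightarrow> sat N (\<lambda>i. bs ! i) \<phi>))"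

lemma same_type_sym: "same_type L M as N bs \<Longrightarrow> same_type L N bs M as"
  by (simp add: same_type_def)

lemma same_type_trans:
  "same_type L M as N bs \<Longrightarrow> same_type L N bs P cs \<Longrightarrow> same_type L M as P cs"
  by (simp add: same_type_def)

lemma same_type_partial_isomorphism:
  "same_type L M as N bs \<Longrightarrow> partial_isomorphism L M as N bs"
  by (simp add: same_type_def partial_isomorphism_def)


section \<open>Embeddings and elementary maps\<close>

definition elementary_map ::
  "('f, 'r) language \<Rightarrow> ('f, 'r, 'a) struct \<Rightarrow> ('f, 'r, 'b) struct \<Rightarrow> ('a \<Rightarrow> 'b) \<Rightarrow> bool"
where
  "elementary_map L M N \<pi> \<longleftrightarrow> \<pi> ` carrier M \<subseteq> carrier N \<and>
     (\<forall>\<phi> e. wf_fm L \<phi> \<and> range e \<subseteq> carrier M \<longrightarrow> (sat M e \<phi> \<longleftrightarrow> sat N (\<pi> \<circ> e) \<phi>))"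

lemma elementary_map_comp:
  assumes "elementary_map L M N \<pi>" and "elementary_map L N P \<rho>"
    and "\<And>x. x \<in> carrier M \<Longrightarrow> \<sigma> x = \<rho> (\<pi> x)"
  shows "elementary_map L M P \<sigma>"
  unfolding elementary_map_def
proof (intro conjI allI impI)
  show "\<sigma> ` carrier M \<subseteq> carrier P"
    using assms by (fastforce simp: elementary_map_def)
next
  fix \<phi> and e :: "nat \<Rightarrow> _"
  assume *: "wf_fm L \<phi> \<and> range e \<subseteq> carrier M"
  have "range (\<pi> \<circ> e) \<subseteq> carrier N"
    using * assms(1) by (auto simp: elementary_map_def)
  moreover have "\<sigma> \<circ> e = \<rho> \<circ> (\<pi> \<circ> e)"
    using * assms(3) by (auto simp: fun_eq_iff)
  ultimately show "sat M e \<phi> \<longleftrightarrow> sat P (\<sigma> \<circ> e) \<phi>"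
    using * assms(1,2) unfolding elementary_map_def by metis
qed

lemma elementary_map_same_type:
  assumes "is_structure L M" and "elementary_map L M N \<pi>" and "set as \<subseteq> carrier M"
  shows "same_type L M as N (map \<pi> as)"
  unfolding same_type_def
proof (intro conjI allI impI)
  fix \<phi>
  assume \<phi>: "wf_fm L \<phi> \<and> free_vars \<phi> \<subseteq> {..<length as}"
  have "sat M (\<lambda>i. as ! i) \<phi> \<longleftrightarrow> sat M (pad M as) \<phi>"
    using \<phi> by (simp add: sat_pad)
  also have "\<dots> \<longleftrightarrow> sat N (\<pi> \<circ> pad M as) \<phi>"
    using \<phi> assms(2) range_pad[OF assms(1,3)] by (simp add: elementary_map_def)
  also have "\<dots> \<longleftrightarrow> sat N (\<lambda>i. map \<pi> as ! i) \<phi>"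
    using \<phi> by (intro sat_cong) (auto simp: pad_def)
  finally show "sat M (\<lambda>i. as ! i) \<phi> \<longleftrightarrow> sat N (\<lambda>i. map \<pi> as ! i) \<phi>" .
qed simp

lemma elementary_map_valid_in:
  assumes "elementary_map L M N \<pi>" and "wf_fm L \<phi>" and "valid_in N \<phi>"
  shows "valid_in M \<phi>"
  unfolding valid_in_def
proof (intro allI impI)
  fix e :: "nat \<Rightarrow> _"
  assume e: "range e \<subseteq> carrier M"
  then have "range (\<pi> \<circ> e) \<subseteq> carrier N"
    using assms(1) by (auto simp: elementary_map_def)
  then show "sat M e \<phi>"
    using e assms by (auto simp: elementary_map_def valid_in_def)
qed

lemma fint_in_carrier:
  "is_structure L M \<Longrightarrow> f \<in> funs L \<Longrightarrow> length xs = farity L f \<Longrightarrow> set xs \<subseteq> carrier M \<Longrightarrow>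
    fint M f xs \<in> carrier M"
  unfolding is_structure_def by meson

lemma tm_val_in_carrier:
  assumes "is_structure L M" and "range e \<subseteq> carrier M" and "wf_tm L t"
  shows "tm_val M e t \<in> carrier M"
  using assms(3)
proof (induction t)
  case (Fn f ts)
  have "set (map (tm_val M e) ts) \<subseteq> carrier M" using Fn by auto
  moreover have "length (map (tm_val M e) ts) = farity L f" "f \<in> funs L"
    using Fn.prems by simp_all
  ultimately have "fint M f (map (tm_val M e) ts) \<in> carrier M"
    by (metis fint_in_carrier assms(1))
  then show ?case by simp
qed (use assms(2) in auto)

lemma embedding_in_carrier:
  "is_embedding L M N \<pi> \<Longrightarrow> x \<in> carrier M \<Longrightarrow> \<pi> x \<in> carrier N"
  by (auto simp: is_embedding_def)

lemma embedding_finite: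
  "is_embedding L M N \<pi> \<Longrightarrow> finite (carrier N) \<Longrightarrow> finite (carrier M)"
  unfolding is_embedding_def by (meson PiE_iff image_subsetI inj_on_finite)

lemma embedding_tm_val:
  assumes "is_structure L M" and "is_embedding L M N \<pi>" and "range e \<subseteq> carrier M"
    and "wf_tm L t"
  shows "\<pi> (tm_val M e t) = tm_val N (\<pi> \<circ> e) t"
  using assms(4)
proof (induction t)
  case (Fn f ts)
  have wf: "f \<in> funs L" "length (map (tm_val M e) ts) = farity L f"
    using Fn.prems by simp_all
  have "set (map (tm_val M e) ts) \<subseteq> carrier M"
    using Fn.prems tm_val_in_carrier[OF assms(1,3)] by auto
  then have "\<pi> (fint M f (map (tm_val M e) ts)) = fint N f (map \<pi> (map (tm_val M e) ts))"
    using wf assms(2) unfolding is_embedding_def by blast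
  moreover have "map \<pi> (map (tm_val M e) ts) = map (tm_val N (\<pi> \<circ> e)) ts"
    using Fn by (auto simp: o_def)
  ultimately show ?case by (metis tm_val.simps(2))
qed simp

lemma embedding_qfree:
  assumes "is_structure L M" and "is_embedding L M N \<pi>" and "range e \<subseteq> carrier M"
    and "wf_fm L \<phi>" and "qfree \<phi>"
  shows "sat M e \<phi> \<longleftrightarrow> sat N (\<pi> \<circ> e) \<phi>"
  using assms(4,5)
proof (induction \<phi>)
  case (Eq s t)
  have "inj_on \<pi> (carrier M)" using assms(2) by (simp add: is_embedding_def)
  then have "tm_val M e s = tm_val M e t \<longleftrightarrow> \<pi> (tm_val M e s) = \<pi> (tm_val M e t)"
    using Eq.prems tm_val_in_carrier[OF assms(1,3)] by (auto dest: inj_onD)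
  then show ?case using Eq.prems embedding_tm_val[OF assms(1-3)] by (simp add: o_def)
next
  case (Rel r ts)
  have wf: "r \<in> rels L" "length (map (tm_val M e) ts) = rarity L r"
    using Rel.prems by simp_all
  have "set (map (tm_val M e) ts) \<subseteq> carrier M"
    using Rel.prems tm_val_in_carrier[OF assms(1,3)] by auto
  then have "rint M r (map (tm_val M e) ts) \<longleftrightarrow> rint N r (map \<pi> (map (tm_val M e) ts))"
    using wf assms(2) unfolding is_embedding_def by blast
  moreover have "map \<pi> (map (tm_val M e) ts) = map (tm_val N (\<pi> \<circ> e)) ts"
    using Rel.prems embedding_tm_val[OF assms(1-3)] by (auto simp: o_def)
  ultimately show ?case by (metis sat.simps(3))
qed auto

abbreviation neg :: "('f, 'r) fm \<Rightarrow> ('f, 'r) fm" where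
  "neg \<phi> \<equiv> Imp \<phi> Bot"

abbreviation ex :: "nat \<Rightarrow> ('f, 'r) fm \<Rightarrow> ('f, 'r) fm" where
  "ex x \<phi> \<equiv> neg (All x (neg \<phi>))"

text \<open>The Tarski-Vaught test: witnesses for existential statements are found in the image.\<close>

lemma tarski_vaught:
  assumes "is_structure L M" and emb: "is_embedding L M N \<pi>"
    and tv: "\<And>\<phi> e x b. wf_fm L \<phi> \<Longrightarrow> range e \<subseteq> carrier M \<Longrightarrow> b \<in> carrier N \<Longrightarrow>
      sat N ((\<pi> \<circ> e)(x := b)) \<phi> \<Longrightarrow> \<exists>a\<in>carrier M. sat N ((\<pi> \<circ> e)(x := \<pi> a)) \<phi>"
  shows "elementary_map L M N \<pi>"
proof -
  have "sat M e \<phi> \<longleftrightarrow> sat N (\<pi> \<circ> e) \<phi>" if "wf_fm L \<phi>" "range e \<subseteq> carrier M" for \<phi> e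
    using that
  proof (induction \<phi> arbitrary: e)
    case (All x \<phi>)
    have upd: "sat M (e(x := a)) \<phi> \<longleftrightarrow> sat N ((\<pi> \<circ> e)(x := \<pi> a)) \<phi>" if "a \<in> carrier M" for a
    proof -
      have "range (e(x := a)) \<subseteq> carrier M" using that All.prems by auto
      then show ?thesis
        using All.IH[of "e(x := a)"] All.prems by (metis fun_upd_comp wf_fm.simps(5))
    qed
    have "sat N ((\<pi> \<circ> e)(x := b)) \<phi>" if "sat M e (All x \<phi>)" "b \<in> carrier N" for b
    proof (rule ccontr)
      assume "\<not> sat N ((\<pi> \<circ> e)(x := b)) \<phi>"
      then obtain a where "a \<in> carrier M" "\<not> sat N ((\<pi> \<circ> e)(x := \<pi> a)) \<phi>"
        using tv[of "neg \<phi>" e b x] All.prems \<open>b \<in> carrier N\<close> by auto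
      then show False using upd that(1) by simp
    qed
    moreover have "sat M (e(x := a)) \<phi>" if "sat N (\<pi> \<circ> e) (All x \<phi>)" "a \<in> carrier M" for a
      using upd that embedding_in_carrier[OF emb] by simp
    ultimately show ?case by (metis sat.simps(5))
  next
    case (Imp \<phi> \<psi>)
    then show ?case by simp
  qed (use embedding_qfree[OF assms(1,2)] in \<open>simp_all del: sat.simps\<close>)
  then show ?thesis
    using embedding_in_carrier[OF emb] by (auto simp: elementary_map_def)
qed

lemma isomorphism_elementary_map:
  assumes "is_structure L M" and "is_embedding L M N \<pi>" and "\<pi> ` carrier M = carrier N"
  shows "elementary_map L M N \<pi>"
  using assms(1,2)
proof (rule tarski_vaught)
  fix \<phi> e x b
  assume "b \<in> carrier N" "sat N ((\<pi> \<circ> e)(x := b)) \<phi>"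
  then show "\<exists>a\<in>carrier M. sat N ((\<pi> \<circ> e)(x := \<pi> a)) \<phi>"
    using assms(3) by (metis imageE)
qed

lemma map_restrict_eq: "set xs \<subseteq> A \<Longrightarrow> map (\<lambda>x\<in>A. f x) xs = map f xs"
  by (intro map_cong) auto

lemma embedding_compose:
  assumes "is_embedding L M N \<pi>" and "is_embedding L N P \<rho>" and "is_structure L M"
  shows "is_embedding L M P (compose (carrier M) \<rho> \<pi>)"
proof -
  have maps: "\<pi> x \<in> carrier N" if "x \<in> carrier M" for x
    using that assms(1) embedding_in_carrier by metis
  have lists: "map (compose (carrier M) \<rho> \<pi>) xs = map \<rho> (map \<pi> xs)"
    and lists': "set (map \<pi> xs) \<subseteq> carrier N" if "set xs \<subseteq> carrier M" for xs
    using that maps by (auto simp: compose_def)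
  show ?thesis
    unfolding is_embedding_def
  proof (intro conjI ballI allI impI)
    show "compose (carrier M) \<rho> \<pi> \<in> carrier M \<rightarrow>\<^sub>E carrier P"
      using maps embedding_in_carrier[OF assms(2)] by (auto simp: compose_def)
    have "inj_on \<rho> (\<pi> ` carrier M)"
      using assms(2) maps by (auto simp: is_embedding_def intro: inj_on_subset)
    then have "inj_on (\<rho> \<circ> \<pi>) (carrier M)"
      using assms(1) by (auto simp: is_embedding_def intro: comp_inj_on)
    then show "inj_on (compose (carrier M) \<rho> \<pi>) (carrier M)"
      by (auto simp: inj_on_def compose_def)
  next
    fix f xs
    assume f: "f \<in> funs L" and xs: "length xs = farity L f \<and> set xs \<subseteq> carrier M"
    have "compose (carrier M) \<rho> \<pi> (fint M f xs) = \<rho> (\<pi> (fint M f xs))"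
      using fint_in_carrier[OF assms(3) f] xs by (simp add: compose_def)
    also have "\<dots> = \<rho> (fint N f (map \<pi> xs))"
      using assms(1) f xs by (simp add: is_embedding_def)
    also have "\<dots> = fint P f (map \<rho> (map \<pi> xs))"
      using assms(2) f xs lists'[of xs] unfolding is_embedding_def by (metis length_map)
    finally show "compose (carrier M) \<rho> \<pi> (fint M f xs)
        = fint P f (map (compose (carrier M) \<rho> \<pi>) xs)"
      using lists xs by metis
  next
    fix r xs
    assume r: "r \<in> rels L" and xs: "length xs = rarity L r \<and> set xs \<subseteq> carrier M"
    have "rint M r xs \<longleftrightarrow> rint N r (map \<pi> xs)"
      using assms(1) r xs by (simp add: is_embedding_def)
    also have "\<dots> \<longleftrightarrow> rint P r (map \<rho> (map \<pi> xs))"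
      using assms(2) r xs lists'[of xs] unfolding is_embedding_def by (metis length_map)
    finally show "rint M r xs \<longleftrightarrow> rint P r (map (compose (carrier M) \<rho> \<pi>) xs)"
      using lists xs by metis
  qed
qed

text \<open>An embedding whose values lie in the image of another embedding factors through it. This gives
  inverses of isomorphisms, and it moves embeddings into a large structure to embeddings into a
  countable part of it.\<close>

lemma embedding_factor:
  assumes "is_structure L M" and "is_structure L N"
    and \<pi>: "is_embedding L M P \<pi>" and g: "is_embedding L N P g"
    and sub: "\<pi> ` carrier M \<subseteq> g ` carrier N"
  obtains \<rho> where "is_embedding L M N \<rho>" "\<And>x. x \<in> carrier M \<Longrightarrow> g (\<rho> x) = \<pi> x"
proof -
  define \<rho> where "\<rho> = (\<lambda>x\<in>carrier M. inv_into (carrier N) g (\<pi> x))"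
  have \<rho>: "\<rho> x \<in> carrier N" "g (\<rho> x) = \<pi> x" if "x \<in> carrier M" for x
  proof -
    have "\<pi> x \<in> g ` carrier N" using sub that by blast
    then show "\<rho> x \<in> carrier N" "g (\<rho> x) = \<pi> x"
      using that by (simp_all add: \<rho>_def inv_into_into f_inv_into_f)
  qed
  have lists: "map g (map \<rho> xs) = map \<pi> xs" and lists': "set (map \<rho> xs) \<subseteq> carrier N"
    if "set xs \<subseteq> carrier M" for xs
    using that \<rho> by auto
  have "is_embedding L M N \<rho>"
    unfolding is_embedding_def
  proof (intro conjI ballI allI impI)
    show "\<rho> \<in> carrier M \<rightarrow>\<^sub>E carrier N"
      using \<rho>(1) by (auto simp: \<rho>_def)
    show "inj_on \<rho> (carrier M)"
      using \<pi> \<rho>(2) unfolding is_embedding_def inj_on_def by metis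
  next
    fix f xs
    assume f: "f \<in> funs L" and xs: "length xs = farity L f \<and> set xs \<subseteq> carrier M"
    have in_M: "fint M f xs \<in> carrier M"
      using fint_in_carrier[OF assms(1) f] xs by simp
    have in_N: "fint N f (map \<rho> xs) \<in> carrier N"
      using fint_in_carrier[OF assms(2) f, of "map \<rho> xs"] xs lists' by simp
    have "g (\<rho> (fint M f xs)) = fint P f (map \<pi> xs)"
      using \<rho>(2)[OF in_M] \<pi> f xs by (simp add: is_embedding_def)
    also have "\<dots> = fint P f (map g (map \<rho> xs))"
      using lists xs by metis
    also have "\<dots> = g (fint N f (map \<rho> xs))"
      using g f xs lists'[of xs] unfolding is_embedding_def by (metis length_map)
    finally show "\<rho> (fint M f xs) = fint N f (map \<rho> xs)"
      using g \<rho>(1)[OF in_M] in_N by (auto simp: is_embedding_def dest: inj_onD)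
  next
    fix r xs
    assume r: "r \<in> rels L" and xs: "length xs = rarity L r \<and> set xs \<subseteq> carrier M"
    have "rint M r xs \<longleftrightarrow> rint P r (map g (map \<rho> xs))"
      using \<pi> r xs lists by (metis is_embedding_def)
    also have "\<dots> \<longleftrightarrow> rint N r (map \<rho> xs)"
      using g r xs lists'[of xs] unfolding is_embedding_def by (metis length_map)
    finally show "rint M r xs \<longleftrightarrow> rint N r (map \<rho> xs)" .
  qed
  then show thesis using that \<rho>(2) by blast
qed


section \<open>Substructures, copies and isomorphisms\<close>

definition substructure ::
  "('f, 'r) language \<Rightarrow> ('f, 'r, 'a) struct \<Rightarrow> 'a set \<Rightarrow> ('f, 'r, 'a) struct"
where
  "substructure L M B =
     \<lparr>carrier = B,
      fint = (\<lambda>f xs. if f \<in> funs L \<and> length xs = farity L f \<and> set xs \<subseteq> B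
                    then fint M f xs else undefined),
      rint = (\<lambda>r xs. set xs \<subseteq> B \<and> rint M r xs)\<rparr>"

lemma carrier_substructure [simp]: "carrier (substructure L M B) = B"
  by (simp add: substructure_def)

lemma is_structure_substructure:
  assumes "is_structure L M" and "B \<noteq> {}"
    and "\<And>f xs. f \<in> funs L \<Longrightarrow> length xs = farity L f \<Longrightarrow> set xs \<subseteq> B \<Longrightarrow> fint M f xs \<in> B"
  shows "is_structure L (substructure L M B)"
  using assms by (auto simp: is_structure_def substructure_def)

lemma substructure_embedding:
  assumes "B \<subseteq> carrier M"
    and "\<And>f xs. f \<in> funs L \<Longrightarrow> length xs = farity L f \<Longrightarrow> set xs \<subseteq> B \<Longrightarrow> fint M f xs \<in> B"
  shows "is_embedding L (substructure L M B) M (\<lambda>x\<in>B. x)"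
  using assms by (auto simp: is_embedding_def substructure_def map_restrict_eq inj_on_def)

text \<open>The structure that a bijection carries over to another set.\<close>

definition copy ::
  "('f, 'r) language \<Rightarrow> ('f, 'r, 'a) struct \<Rightarrow> ('a \<Rightarrow> 'b) \<Rightarrow> ('f, 'r, 'b) struct"
where
  "copy L M h =
     \<lparr>carrier = h ` carrier M,
      fint = (\<lambda>f xs. if f \<in> funs L \<and> length xs = farity L f \<and> set xs \<subseteq> h ` carrier M
                    then h (fint M f (map (inv_into (carrier M) h) xs)) else undefined),
      rint = (\<lambda>r xs. set xs \<subseteq> h ` carrier M \<and> rint M r (map (inv_into (carrier M) h) xs))\<rparr>"

lemma is_structure_copy:
  assumes "is_structure L M"
  shows "is_structure L (copy L M h)"
proof -
  have inv: "set (map (inv_into (carrier M) h) xs) \<subseteq> carrier M" if "set xs \<subseteq> h ` carrier M" for xs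
    using that by (auto intro: inv_into_into)
  have "fint M f (map (inv_into (carrier M) h) xs) \<in> carrier M"
    if "f \<in> funs L" "length xs = farity L f" "set xs \<subseteq> h ` carrier M" for f xs
    using fint_in_carrier[OF assms that(1), of "map (inv_into (carrier M) h) xs"] that inv by simp
  moreover have "r \<in> rels L \<and> length xs = rarity L r"
    if "rint M r (map (inv_into (carrier M) h) xs)" for r xs
    using that assms unfolding is_structure_def by (metis length_map)
  moreover have "carrier M \<noteq> {}" using assms by (simp add: is_structure_def)
  ultimately show ?thesis by (auto simp: is_structure_def copy_def)
qed

lemma copy_isomorphism:
  assumes "inj_on h (carrier M)" and "is_structure L M"
  shows "is_embedding L M (copy L M h) (\<lambda>x\<in>carrier M. h x)"
proof -
  have inv: "map (inv_into (carrier M) h) (map (\<lambda>x\<in>carrier M. h x) xs) = xs"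
    if "set xs \<subseteq> carrier M" for xs
    using that assms(1) by (auto simp: map_restrict_eq intro!: map_idI)
  have sub: "set (map (\<lambda>x\<in>carrier M. h x) xs) \<subseteq> h ` carrier M" if "set xs \<subseteq> carrier M" for xs
    using that by auto
  show ?thesis
    unfolding is_embedding_def
  proof (intro conjI ballI allI impI)
    show "(\<lambda>x\<in>carrier M. h x) \<in> carrier M \<rightarrow>\<^sub>E carrier (copy L M h)"
      by (auto simp: copy_def)
    show "inj_on (\<lambda>x\<in>carrier M. h x) (carrier M)"
      using assms(1) by (simp add: inj_on_def)
  next
    fix f xs
    assume "f \<in> funs L" "length xs = farity L f \<and> set xs \<subseteq> carrier M"
    then show "(\<lambda>x\<in>carrier M. h x) (fint M f xs)
        = fint (copy L M h) f (map (\<lambda>x\<in>carrier M. h x) xs)"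
      using inv sub fint_in_carrier[OF assms(2)] by (simp add: copy_def del: map_map)
  next
    fix r xs
    assume "r \<in> rels L" "length xs = rarity L r \<and> set xs \<subseteq> carrier M"
    then show "rint M r xs \<longleftrightarrow> rint (copy L M h) r (map (\<lambda>x\<in>carrier M. h x) xs)"
      using inv sub by (simp add: copy_def del: map_map)
  qed
qed

lemma identity_embedding: "is_structure L M \<Longrightarrow> is_embedding L M M (\<lambda>x\<in>carrier M. x)"
  by (auto simp: is_embedding_def map_restrict_eq fint_in_carrier inj_on_def)

lemma isomorphic_sym:
  assumes "is_structure L M" and "is_structure L N" and "isomorphic L M N"
  shows "isomorphic L N M"
proof -
  obtain \<pi> where \<pi>: "is_embedding L M N \<pi>" "\<pi> ` carrier M = carrier N"
    using assms(3) by (auto simp: isomorphic_def)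
  obtain \<rho> where \<rho>: "is_embedding L N M \<rho>" "\<And>x. x \<in> carrier N \<Longrightarrow> \<pi> (\<rho> x) = (\<lambda>x\<in>carrier N. x) x"
    using embedding_factor[OF assms(2,1) identity_embedding[OF assms(2)] \<pi>(1)] \<pi>(2) by auto
  have "x \<in> \<rho> ` carrier N" if "x \<in> carrier M" for x
  proof -
    have "\<pi> x \<in> carrier N" using that embedding_in_carrier[OF \<pi>(1)] by simp
    then have "\<pi> (\<rho> (\<pi> x)) = \<pi> x" "\<rho> (\<pi> x) \<in> carrier M"
      using \<rho>(2) embedding_in_carrier[OF \<rho>(1)] by simp_all
    then have "\<rho> (\<pi> x) = x"
      using that \<pi>(1) by (auto simp: is_embedding_def dest: inj_onD)
    then show ?thesis using \<open>\<pi> x \<in> carrier N\<close> by (metis imageI)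
  qed
  then have "\<rho> ` carrier N = carrier M"
    using embedding_in_carrier[OF \<rho>(1)] by auto
  then show ?thesis using \<rho>(1) by (auto simp: isomorphic_def)
qed

lemma isomorphic_trans:
  assumes "is_structure L M" and "isomorphic L M N" and "isomorphic L N P"
  shows "isomorphic L M P"
proof -
  obtain \<pi> \<rho> where \<pi>: "is_embedding L M N \<pi>" "\<pi> ` carrier M = carrier N"
    and \<rho>: "is_embedding L N P \<rho>" "\<rho> ` carrier N = carrier P"
    using assms(2,3) by (auto simp: isomorphic_def)
  have "compose (carrier M) \<rho> \<pi> ` carrier M = \<rho> ` \<pi> ` carrier M"
    by (auto simp: compose_def)
  then show ?thesis
    using embedding_compose[OF \<pi>(1) \<rho>(1) assms(1)] \<pi>(2) \<rho>(2) by (auto simp: isomorphic_def)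
qed

lemma isomorphic_is_model:
  assumes "is_model L T M" and "is_structure L N" and "isomorphic L M N"
    and "\<forall>\<phi>\<in>T. wf_fm L \<phi>"
  shows "is_model L T N"
proof -
  have M: "is_structure L M" using assms(1) by (simp add: is_model_def)
  then obtain \<rho> where \<rho>: "is_embedding L N M \<rho>" "\<rho> ` carrier N = carrier M"
    using isomorphic_sym assms(2,3) unfolding isomorphic_def by metis
  then have "elementary_map L N M \<rho>"
    using isomorphism_elementary_map assms(2) by metis
  then show ?thesis
    using elementary_map_valid_in assms(1,2,4) unfolding is_model_def by metis
qed

lemma isomorphic_copy:
  "is_structure L M \<Longrightarrow> inj_on h (carrier M) \<Longrightarrow> isomorphic L M (copy L M h)"
  unfolding isomorphic_def by (rule exI, rule conjI, rule copy_isomorphism) (auto simp: copy_def)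

text \<open>Countable models on any carrier can be copied to the natural numbers, where categoricity is
  stated.\<close>

lemma countable_models_isomorphic:
  assumes "aleph0_categorical L T" and wf: "\<forall>\<phi>\<in>T. wf_fm L \<phi>"
    and M: "is_model L T M" "infinite (carrier M)" "countable (carrier M)"
    and N: "is_model L T N" "infinite (carrier N)" "countable (carrier N)"
  shows "isomorphic L M N"
proof -
  have st: "is_structure L M" "is_structure L N"
    using M N by (simp_all add: is_model_def)
  let ?M = "copy L M (to_nat_on (carrier M))" and ?N = "copy L N (to_nat_on (carrier N))"
  have inj: "inj_on (to_nat_on (carrier M)) (carrier M)" "inj_on (to_nat_on (carrier N)) (carrier N)"
    using M N by (blast intro: inj_on_to_nat_on)+
  have iso: "isomorphic L M ?M" "isomorphic L N ?N"
    using isomorphic_copy st inj by blast+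
  have "is_model L T ?M" "is_model L T ?N"
    using isomorphic_is_model[OF _ is_structure_copy iso(1) wf]
      isomorphic_is_model[OF _ is_structure_copy iso(2) wf] M N st by blast+
  moreover have "infinite (carrier ?M)" "infinite (carrier ?N)"
    using M N inj by (simp_all add: copy_def finite_image_iff)
  ultimately have "isomorphic L ?M ?N"
    using assms(1) by (simp add: aleph0_categorical_def)
  moreover have "isomorphic L ?N N"
    using isomorphic_sym[OF st(2) is_structure_copy[OF st(2)] iso(2)] .
  ultimately show ?thesis
    using isomorphic_trans iso(1) st is_structure_copy by metis
qed


section \<open>Elementary substructures closed under further operations\<close>

text \<open>The union of countably many rounds of closing up is closed, since a list is finite and so lies
  in one of the rounds.\<close>

lemma countable_closure:
  fixes G :: "'a list \<Rightarrow> 'a set"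
  assumes "countable A" and "A \<subseteq> C"
    and G: "\<And>xs. set xs \<subseteq> C \<Longrightarrow> countable (G xs) \<and> G xs \<subseteq> C"
  obtains B where "countable B" "A \<subseteq> B" "B \<subseteq> C" "\<And>xs. set xs \<subseteq> B \<Longrightarrow> G xs \<subseteq> B"
proof -
  define F where "F = rec_nat A (\<lambda>_ X. X \<union> (\<Union>xs\<in>lists X. G xs))"
  have F0: "F 0 = A" and FS: "F (Suc n) = F n \<union> (\<Union>xs\<in>lists (F n). G xs)" for n
    by (simp_all add: F_def)
  have F: "countable (F n) \<and> F n \<subseteq> C" for n
  proof (induction n)
    case (Suc n)
    have *: "countable (G xs) \<and> G xs \<subseteq> C" if "xs \<in> lists (F n)" for xs
    proof (rule G)
      show "set xs \<subseteq> C" using that Suc by fast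
    qed
    have "countable (lists (F n))" using Suc by (simp add: countable_lists)
    then have "countable (\<Union>xs\<in>lists (F n). G xs)"
      by (rule countable_UN) (simp add: *)
    moreover have "(\<Union>xs\<in>lists (F n). G xs) \<subseteq> C"
      by (rule UN_least) (simp add: *)
    ultimately show ?case using Suc by (simp add: FS)
  qed (use assms(1,2) F0 in simp)
  have mono: "F m \<subseteq> F n" if "m \<le> n" for m n
    by (rule lift_Suc_mono_le[OF _ that]) (simp add: FS)
  have level: "\<exists>n. set xs \<subseteq> F n" if "set xs \<subseteq> (\<Union>n. F n)" for xs
    using that
  proof (induction xs)
    case (Cons x xs)
    have "x \<in> (\<Union>n. F n)" and "set xs \<subseteq> (\<Union>n. F n)" using Cons.prems by simp_all
    then obtain m n where m: "x \<in> F m" and n: "set xs \<subseteq> F n" using Cons.IH by blast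
    have "F m \<subseteq> F (max m n)" "F n \<subseteq> F (max m n)"
      by (rule mono, simp)+
    then have "set (x # xs) \<subseteq> F (max m n)"
      using m n by (simp add: subset_iff)
    then show ?case by (rule exI)
  qed simp
  have closed: "G xs \<subseteq> (\<Union>n. F n)" if "set xs \<subseteq> (\<Union>n. F n)" for xs
  proof -
    from level[OF that] obtain n where "set xs \<subseteq> F n" by (rule exE)
    then have "xs \<in> lists (F n)" by (simp add: lists_eq_set)
    then have "G xs \<subseteq> F (Suc n)" by (simp add: FS UN_upper le_supI2)
    then show ?thesis by (rule order_trans) (rule UN_upper, rule UNIV_I)
  qed
  show thesis
  proof (rule that[of "\<Union>n. F n"])
    show "countable (\<Union>n. F n)" using F by simp
    show "(\<Union>n. F n) \<subseteq> C" using F by (simp add: UN_least)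
    show "A \<subseteq> (\<Union>n. F n)" using F0 by blast
  qed (rule closed)
qed

lemma countable_terms:
  assumes "countable_language L"
  shows "countable {t. wf_tm L t}"
proof -
  define G where "G ts = (\<lambda>f. Fn f ts) ` funs L" for ts
  have G: "countable (G ts) \<and> G ts \<subseteq> UNIV" for ts
    using assms by (simp add: G_def countable_language_def)
  obtain B where B: "countable B" "range Var \<subseteq> B" "\<And>ts. set ts \<subseteq> B \<Longrightarrow> G ts \<subseteq> B"
    by (rule countable_closure[where A = "range Var" and G = G, OF _ subset_UNIV G]) (simp, rule that)
  have "t \<in> B" if "wf_tm L t" for t
    using that
  proof (induction t)
    case (Fn f ts)
    then show ?case using B(3)[of ts] by (auto simp: G_def)
  qed (use B in auto)
  then show ?thesis using B(1) by (auto intro: countable_subset)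
qed

lemma countable_formulas:
  assumes "countable_language L"
  shows "countable {\<phi>. wf_fm L \<phi>}"
proof -
  let ?T = "{t. wf_tm L t}"
  let ?A = "{Bot} \<union> (\<lambda>(s, t). Eq s t) ` (?T \<times> ?T) \<union> (\<lambda>(r, ts). Rel r ts) ` (rels L \<times> lists ?T)"
  define G :: "('a, 'b) fm list \<Rightarrow> ('a, 'b) fm set"
    where "G \<Phi> = {Imp (\<Phi> ! 0) (\<Phi> ! 1)} \<union> range (\<lambda>x. All x (\<Phi> ! 0))" for \<Phi>
  have A: "countable ?A"
    using assms countable_terms[OF assms] by (auto simp: countable_language_def)
  have G: "countable (G \<Phi>) \<and> G \<Phi> \<subseteq> UNIV" for \<Phi>
    by (simp add: G_def)
  obtain B where B: "countable B" "?A \<subseteq> B" "\<And>\<Phi>. set \<Phi> \<subseteq> B \<Longrightarrow> G \<Phi> \<subseteq> B"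
    by (rule countable_closure[where G = G, OF A subset_UNIV G]) (rule that)
  have "\<phi> \<in> B" if "wf_fm L \<phi>" for \<phi>
    using that
  proof (induction \<phi>)
    case (Imp \<phi> \<psi>)
    then show ?case using B(3)[of "[\<phi>, \<psi>]"] by (auto simp: G_def)
  next
    case (All x \<phi>)
    then show ?case using B(3)[of "[\<phi>]"] by (auto simp: G_def)
  next
    case (Eq s t)
    then show ?case using B(2) by auto
  next
    case (Rel r ts)
    then have "(r, ts) \<in> rels L \<times> lists ?T" by auto
    then show ?case using B(2) by blast
  qed (use B in auto)
  then show ?thesis using B(1) by (auto intro: countable_subset)
qed

text \<open>The construction that proves the downward Loewenheim-Skolem theorem can close the
  substructure under further countable-valued operations at the same time.\<close>

lemma elementary_substructure_closed_under:
  fixes M :: "('f, 'r, 'a) struct"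
  assumes L: "countable_language L" and M: "is_structure L M"
    and A: "countable A" "A \<subseteq> carrier M"
    and H: "\<And>xs. set xs \<subseteq> carrier M \<Longrightarrow> countable (H xs) \<and> H xs \<subseteq> carrier M"
  obtains B where "countable B" "A \<subseteq> B" "B \<subseteq> carrier M" "\<And>xs. set xs \<subseteq> B \<Longrightarrow> H xs \<subseteq> B"
    "is_structure L (substructure L M B)"
    "is_embedding L (substructure L M B) M (\<lambda>x\<in>B. x)"
    "elementary_map L (substructure L M B) M (\<lambda>x\<in>B. x)"
proof -
  define wit where "wit xs x \<phi> = (SOME b. b \<in> carrier M \<and>
    ((\<exists>b\<in>carrier M. sat M ((\<lambda>i. xs ! i)(x := b)) \<phi>) \<longrightarrow> sat M ((\<lambda>i. xs ! i)(x := b)) \<phi>))"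
    for xs x \<phi>
  have "carrier M \<noteq> {}" using M by (simp add: is_structure_def)
  then have "\<exists>b. b \<in> carrier M \<and>
    ((\<exists>b\<in>carrier M. sat M ((\<lambda>i. xs ! i)(x := b)) \<phi>) \<longrightarrow> sat M ((\<lambda>i. xs ! i)(x := b)) \<phi>)"
    for xs x \<phi> by blast
  then have wit: "wit xs x \<phi> \<in> carrier M" "(\<exists>b\<in>carrier M. sat M ((\<lambda>i. xs ! i)(x := b)) \<phi>) \<Longrightarrow>
      sat M ((\<lambda>i. xs ! i)(x := wit xs x \<phi>)) \<phi>" for xs x \<phi>
    unfolding wit_def by (metis (mono_tags, lifting) someI_ex)+
  define G where "G xs = H xs \<union> (\<lambda>(x, \<phi>). wit xs x \<phi>) ` (UNIV \<times> {\<phi>. wf_fm L \<phi>})" for xs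
  have wit_G: "wit xs x \<phi> \<in> G xs" if "wf_fm L \<phi>" for xs x \<phi>
    using that by (force simp: G_def)
  have "countable ((UNIV :: nat set) \<times> {\<phi>. wf_fm L \<phi>})"
    using countable_formulas[OF L] by (intro countable_SIGMA) auto
  then have G: "countable (G xs) \<and> G xs \<subseteq> carrier M" if "set xs \<subseteq> carrier M" for xs
    using H[OF that] wit(1) by (auto simp: G_def)
  obtain B where B: "countable B" "A \<subseteq> B" "B \<subseteq> carrier M"
    and closed: "\<And>xs. set xs \<subseteq> B \<Longrightarrow> G xs \<subseteq> B"
    by (rule countable_closure[where G = G, OF A G]) (assumption, rule that)
  have tv: "\<exists>a\<in>B. sat M (e(x := a)) \<phi>"
    if \<phi>: "wf_fm L \<phi>" and e: "range e \<subseteq> B" and b: "b \<in> carrier M" "sat M (e(x := b)) \<phi>" for \<phi> e x b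
  proof -
    \<comment> \<open>Only finitely many values of the assignment matter, so the witness chosen for a list of values
      serves for the assignment.\<close>
    obtain n where n: "free_vars \<phi> \<subseteq> {..<n}"
      using finite_free_vars finite_nat_iff_bounded by metis
    define xs where "xs = map e [0..<n]"
    have eq: "sat M (e(x := a)) \<phi> \<longleftrightarrow> sat M ((\<lambda>i. xs ! i)(x := a)) \<phi>" for a
      using n by (intro sat_cong) (auto simp: xs_def)
    have "wit xs x \<phi> \<in> G xs" using \<phi> wit_G by blast
    moreover have "set xs \<subseteq> B" using e by (auto simp: xs_def)
    ultimately have "wit xs x \<phi> \<in> B" using closed by blast
    moreover have "sat M (e(x := wit xs x \<phi>)) \<phi>"
      using wit(2) b eq by blast
    ultimately show ?thesis by blast
  qed
  have "wit [] 0 (Eq (Var 0) (Var 0)) \<in> G []" using wit_G by simp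
  then have "B \<noteq> {}" using closed[of "[]"] by auto
  \<comment> \<open>Closure under functions is the Tarski-Vaught condition for the formula \<open>y = f(x)\<close>.\<close>
  have fint: "fint M f xs \<in> B" if f: "f \<in> funs L" "length xs = farity L f" "set xs \<subseteq> B" for f xs
  proof -
    define n where "n = length xs"
    define \<phi> :: "('f, 'r) fm" where "\<phi> = Eq (Var n) (Fn f (map Var [0..<n]))"
    obtain b0 where "b0 \<in> B" using \<open>B \<noteq> {}\<close> by blast
    define e where "e i = (if i < n then xs ! i else b0)" for i
    have vals: "map (tm_val M (e(n := a)) \<circ> Var) [0..<n] = xs" for a
      by (rule nth_equalityI) (auto simp: e_def n_def)
    have sat: "sat M (e(n := a)) \<phi> \<longleftrightarrow> a = fint M f xs" for a
      using vals by (simp add: \<phi>_def)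
    have "wf_fm L \<phi>" using f by (auto simp: \<phi>_def n_def)
    moreover have "range e \<subseteq> B" using f(3) \<open>b0 \<in> B\<close> by (auto simp: e_def n_def)
    moreover have "fint M f xs \<in> carrier M" using fint_in_carrier[OF M f(1,2)] f(3) B(3) by blast
    ultimately show ?thesis using tv[of \<phi> e "fint M f xs" n] sat by auto
  qed
  let ?S = "substructure L M B"
  have S: "is_structure L ?S"
    using is_structure_substructure[OF M \<open>B \<noteq> {}\<close> fint] .
  have emb: "is_embedding L ?S M (\<lambda>x\<in>B. x)"
    using substructure_embedding[OF B(3) fint] .
  have "elementary_map L ?S M (\<lambda>x\<in>B. x)"
    using S emb
  proof (rule tarski_vaught)
    fix \<phi> x b and e :: "nat \<Rightarrow> 'a"
    assume *: "wf_fm L \<phi>" "range e \<subseteq> carrier ?S" "b \<in> carrier M"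
      "sat M (((\<lambda>x\<in>B. x) \<circ> e)(x := b)) \<phi>"
    have "(\<lambda>x\<in>B. x) \<circ> e = e" using *(2) by (auto simp: fun_eq_iff)
    then show "\<exists>a\<in>carrier ?S. sat M (((\<lambda>x\<in>B. x) \<circ> e)(x := (\<lambda>x\<in>B. x) a)) \<phi>"
      using tv[OF *(1) _ *(3)] * by auto
  qed
  moreover have "H xs \<subseteq> B" if "set xs \<subseteq> B" for xs
    using closed[OF that] by (simp add: G_def)
  ultimately show thesis using that[of B] B S emb by blast
qed


section \<open>Ultrapowers over the natural numbers\<close>

text \<open>A minimal proper filter below \<open>sequentially\<close> decides every predicate, as otherwise it could be
  refined by the negation. Minimal filters exist by the lemma of Zorn, since the infimum of a chain
  of proper filters is proper.\<close>

lemma free_ultrafilter_exists: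
  obtains U :: "nat filter" where "U \<noteq> bot" and "U \<le> sequentially"
    and "\<And>P. eventually P U \<or> eventually (\<lambda>i. \<not> P i) U"
proof -
  define A where "A = {F :: nat filter. F \<noteq> bot \<and> F \<le> sequentially}"
  have "\<exists>m\<in>A. \<forall>F\<in>A. m \<ge> F \<longrightarrow> F = m"
  proof (rule predicate_Zorn)
    show "partial_order_on A (relation_of (\<ge>) A)"
      by (rule partial_order_on_relation_ofI) auto
    fix C
    assume "C \<in> Chains (relation_of (\<ge>) A)"
    then have C: "C \<subseteq> A" "\<And>F G. F \<in> C \<Longrightarrow> G \<in> C \<Longrightarrow> F \<le> G \<or> G \<le> F"
      by (auto simp: Chains_def relation_of_def)
    show "\<exists>u\<in>A. \<forall>F\<in>C. F \<ge> u"
    proof (cases "C = {}")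
      case True
      have "sequentially \<in> A" by (simp add: A_def)
      then show ?thesis using True by blast
    next
      case False
      have "eventually P (Inf C) \<longleftrightarrow> (\<exists>F\<in>C. eventually P F)" for P
      proof (rule eventually_Inf_base[OF False])
        fix F G
        assume "F \<in> C" "G \<in> C"
        then show "\<exists>H\<in>C. H \<le> inf F G" using C(2)[of F G] by (metis inf.order_iff inf.commute order_refl)
      qed
      then have "Inf C \<noteq> bot"
        using C(1) by (auto simp: trivial_limit_def A_def)
      moreover obtain F where "F \<in> C" using False by blast
      then have "Inf C \<le> sequentially"
        using C(1) by (auto simp: A_def intro: Inf_lower2)
      ultimately show ?thesis by (auto simp: A_def intro!: bexI[of _ "Inf C"] Inf_lower)
    qed
  qed
  then obtain U where U: "U \<in> A" and min: "\<And>F. F \<in> A \<Longrightarrow> F \<le> U \<Longrightarrow> F = U" by blast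
  have "eventually P U \<or> eventually (\<lambda>i. \<not> P i) U" for P
  proof (cases "eventually P U")
    case False
    let ?F = "inf U (principal {i. \<not> P i})"
    have "?F \<noteq> bot"
      using False by (simp add: trivial_limit_def eventually_inf_principal)
    moreover have "?F \<le> sequentially"
      using U by (auto simp: A_def intro: le_infI1)
    ultimately have "?F = U" by (intro min) (simp_all add: A_def)
    then have "U \<le> principal {i. \<not> P i}" by (metis inf.cobounded2)
    then show ?thesis by (simp add: le_principal)
  qed simp
  then show thesis using U by (intro that[of U]) (simp_all add: A_def)
qed

text \<open>The elements of the ultrapower are canonical representatives of the classes of sequences that
  agree almost everywhere, so that equality in it is equality.\<close>

locale ultrapower =
  fixes U :: "nat filter" and L :: "('f, 'r) language" and W :: "('f, 'r, 'a) struct"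
  assumes proper: "U \<noteq> bot" and free: "U \<le> sequentially"
    and ultra: "\<And>P. eventually P U \<or> eventually (\<lambda>i. \<not> P i) U"
    and W: "is_structure L W"
begin

definition canon :: "(nat \<Rightarrow> 'a) \<Rightarrow> nat \<Rightarrow> 'a" where
  "canon x = (SOME y. range y \<subseteq> carrier W \<and> eventually (\<lambda>i. y i = x i) U)"

definition classes :: "(nat \<Rightarrow> 'a) set" where
  "classes = canon ` {x. range x \<subseteq> carrier W}"

definition upower :: "('f, 'r, nat \<Rightarrow> 'a) struct" where
  "upower =
     \<lparr>carrier = classes,
      fint = (\<lambda>f xs. if f \<in> funs L \<and> length xs = farity L f \<and> set xs \<subseteq> classes
                    then canon (\<lambda>i. fint W f (map (\<lambda>x. x i) xs)) else undefined),
      rint = (\<lambda>r xs. set xs \<subseteq> classes \<and> eventually (\<lambda>i. rint W r (map (\<lambda>x. x i) xs)) U)\<rparr>"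

lemma carrier_upower [simp]: "carrier upower = classes"
  by (simp add: upower_def)

lemma canon:
  assumes "range x \<subseteq> carrier W"
  shows "range (canon x) \<subseteq> carrier W" "eventually (\<lambda>i. canon x i = x i) U" "canon x \<in> classes"
proof -
  have "\<exists>y. range y \<subseteq> carrier W \<and> eventually (\<lambda>i. y i = x i) U"
    using assms by (intro exI[of _ x]) simp
  then have "range (canon x) \<subseteq> carrier W \<and> eventually (\<lambda>i. canon x i = x i) U"
    unfolding canon_def by (rule someI_ex)
  then show "range (canon x) \<subseteq> carrier W" "eventually (\<lambda>i. canon x i = x i) U" by simp_all
  show "canon x \<in> classes" using assms by (simp add: classes_def)
qed

lemma classes_in_carrier: "x \<in> classes \<Longrightarrow> x i \<in> carrier W"
  using canon(1) by (auto simp: classes_def)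

lemma canon_eqI:
  assumes "eventually (\<lambda>i. x i = y i) U"
  shows "canon x = canon y"
proof -
  have "eventually (\<lambda>i. z i = x i) U \<longleftrightarrow> eventually (\<lambda>i. z i = y i) U" for z
    using assms by (auto elim: eventually_elim2)
  then show ?thesis by (simp add: canon_def)
qed

lemma classes_eqI:
  assumes "x \<in> classes" "y \<in> classes" "eventually (\<lambda>i. x i = y i) U"
  shows "x = y"
proof -
  obtain x' y' where x': "range x' \<subseteq> carrier W" "x = canon x'"
    and y': "range y' \<subseteq> carrier W" "y = canon y'"
    using assms by (auto simp: classes_def)
  have "eventually (\<lambda>i. x' i = y' i) U"
    using canon(2)[OF x'(1)] canon(2)[OF y'(1)] assms(3) unfolding x'(2) y'(2)
    by eventually_elim simp
  then show ?thesis using canon_eqI x' y' by simp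
qed

lemma fint_sequence:
  assumes "f \<in> funs L" "length xs = farity L f" "set xs \<subseteq> classes"
  shows "range (\<lambda>i. fint W f (map (\<lambda>x. x i) xs)) \<subseteq> carrier W"
proof safe
  fix i
  have "set (map (\<lambda>x. x i) xs) \<subseteq> carrier W" using assms(3) classes_in_carrier by auto
  then show "fint W f (map (\<lambda>x. x i) xs) \<in> carrier W"
    using fint_in_carrier[OF W assms(1)] assms(2) by simp
qed

lemma is_structure_upower: "is_structure L upower"
  unfolding is_structure_def
proof (intro conjI allI impI)
  obtain w where "w \<in> carrier W" using W by (auto simp: is_structure_def)
  then have "range (\<lambda>_. w) \<subseteq> carrier W" by auto
  then show "carrier upower \<noteq> {}" using canon(3) by fastforce
next
  fix f xs
  show "if f \<in> funs L \<and> length xs = farity L f \<and> set xs \<subseteq> carrier upower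
    then fint upower f xs \<in> carrier upower else fint upower f xs = undefined"
    using canon(3)[OF fint_sequence] by (simp add: upower_def)
next
  fix r xs
  assume r: "rint upower r xs"
  then show "set xs \<subseteq> carrier upower" by (simp add: upower_def)
  have "eventually (\<lambda>i. rint W r (map (\<lambda>x. x i) xs)) U" using r by (simp add: upower_def)
  from eventually_happens'[OF proper this] obtain i where "rint W r (map (\<lambda>x. x i) xs)" ..
  then show "r \<in> rels L" "length xs = rarity L r"
    using W unfolding is_structure_def by (metis length_map)+
qed

lemma tm_val_upower:
  assumes e: "range e \<subseteq> classes" and "wf_tm L t"
  shows "eventually (\<lambda>i. tm_val upower e t i = tm_val W (\<lambda>v. e v i) t) U"
  using assms(2)
proof (induction t)
  case (Fn f ts)
  let ?xs = "map (tm_val upower e) ts"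
  have f: "f \<in> funs L" "length ?xs = farity L f" using Fn.prems by simp_all
  have xs: "set ?xs \<subseteq> classes"
    using Fn.prems e tm_val_in_carrier[OF is_structure_upower, of e] by auto
  have *: "eventually (\<lambda>i. canon (\<lambda>i. fint W f (map (\<lambda>x. x i) ?xs)) i
      = fint W f (map (\<lambda>x. x i) ?xs)) U"
    using canon(2)[OF fint_sequence[OF f xs]] .
  have ts: "eventually (\<lambda>i. \<forall>t\<in>set ts. tm_val upower e t i = tm_val W (\<lambda>v. e v i) t) U"
    using Fn by (intro eventually_ball_finite) auto
  have val: "tm_val upower e (Fn f ts) = canon (\<lambda>i. fint W f (map (\<lambda>x. x i) ?xs))"
    using f xs by (simp add: upower_def)
  show ?case
    unfolding val using * ts
  proof eventually_elim
    case (elim i)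
    have "map (\<lambda>x. x i) ?xs = map (tm_val W (\<lambda>v. e v i)) ts" using elim(2) by auto
    then show ?case using elim(1) by (metis tm_val.simps(2))
  qed
qed simp

text \<open>The theorem of Los. The ultrafilter property is what makes satisfaction commute with
  implication; for a failing universal formula a sequence of counterexamples is chosen
  coordinatewise.\<close>

theorem sat_upower_iff:
  assumes "range e \<subseteq> classes" and "wf_fm L \<phi>"
  shows "sat upower e \<phi> \<longleftrightarrow> eventually (\<lambda>i. sat W (\<lambda>v. e v i) \<phi>) U"
  using assms
proof (induction \<phi> arbitrary: e)
  case Bot
  then show ?case using proper by (simp add: trivial_limit_def)
next
  case (Eq s t)
  have s: "eventually (\<lambda>i. tm_val upower e s i = tm_val W (\<lambda>v. e v i) s) U"
    and t: "eventually (\<lambda>i. tm_val upower e t i = tm_val W (\<lambda>v. e v i) t) U"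
    using Eq by (auto intro: tm_val_upower)
  have "tm_val upower e s \<in> classes" "tm_val upower e t \<in> classes"
    using Eq tm_val_in_carrier[OF is_structure_upower, of e] by simp_all
  then have "tm_val upower e s = tm_val upower e t \<longleftrightarrow>
      eventually (\<lambda>i. tm_val upower e s i = tm_val upower e t i) U"
    using classes_eqI by auto
  also have "\<dots> \<longleftrightarrow> eventually (\<lambda>i. tm_val W (\<lambda>v. e v i) s = tm_val W (\<lambda>v. e v i) t) U"
    by (rule eventually_cong[OF eventually_conj[OF s t]]) auto
  finally show ?case by simp
next
  case (Rel r ts)
  let ?xs = "map (tm_val upower e) ts"
  have xs: "set ?xs \<subseteq> classes"
    using Rel tm_val_in_carrier[OF is_structure_upower, of e] by auto
  have ts: "eventually (\<lambda>i. \<forall>t\<in>set ts. tm_val upower e t i = tm_val W (\<lambda>v. e v i) t) U"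
    using Rel by (intro eventually_ball_finite ballI tm_val_upower) auto
  have "sat upower e (Rel r ts) \<longleftrightarrow> eventually (\<lambda>i. rint W r (map (\<lambda>x. x i) ?xs)) U"
    using xs by (simp add: upower_def)
  also have "\<dots> \<longleftrightarrow> eventually (\<lambda>i. sat W (\<lambda>v. e v i) (Rel r ts)) U"
  proof (rule eventually_cong[OF ts])
    fix i
    assume "\<forall>t\<in>set ts. tm_val upower e t i = tm_val W (\<lambda>v. e v i) t"
    then have "map (\<lambda>x. x i) ?xs = map (tm_val W (\<lambda>v. e v i)) ts" by auto
    then show "rint W r (map (\<lambda>x. x i) ?xs) \<longleftrightarrow> sat W (\<lambda>v. e v i) (Rel r ts)"
      by (metis sat.simps(3))
  qed
  finally show ?case .
next
  case (Imp \<phi> \<psi>)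
  have "eventually (\<lambda>i. A i \<longrightarrow> B i) U \<longleftrightarrow> (eventually A U \<longrightarrow> eventually B U)" for A B
  proof
    assume "eventually A U \<longrightarrow> eventually B U"
    then have "eventually (\<lambda>i. \<not> A i) U \<or> eventually B U" using ultra[of A] by blast
    then show "eventually (\<lambda>i. A i \<longrightarrow> B i) U" by (auto elim: eventually_mono)
  qed (auto elim: eventually_mp)
  then show ?case using Imp by simp
next
  case (All x \<phi>)
  have upd: "(\<lambda>v. (e(x := c)) v i) = (\<lambda>v. e v i)(x := c i)" for c i by auto
  have IH: "sat upower (e(x := c)) \<phi> \<longleftrightarrow> eventually (\<lambda>i. sat W ((\<lambda>v. e v i)(x := c i)) \<phi>) U"
    if "c \<in> classes" for c
  proof -
    have "range (e(x := c)) \<subseteq> classes" using All.prems that by auto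
    from All.IH[OF this] show ?thesis using All.prems unfolding upd by (metis wf_fm.simps(5))
  qed
  show ?case
  proof
    assume all: "sat upower e (All x \<phi>)"
    show "eventually (\<lambda>i. sat W (\<lambda>v. e v i) (All x \<phi>)) U"
    proof (rule ccontr)
      assume "\<not> ?thesis"
      then have fails: "eventually (\<lambda>i. \<not> sat W (\<lambda>v. e v i) (All x \<phi>)) U" using ultra by blast
      have "\<exists>a\<in>carrier W. \<not> sat W (\<lambda>v. e v i) (All x \<phi>) \<longrightarrow> \<not> sat W ((\<lambda>v. e v i)(x := a)) \<phi>" for i
      proof -
        obtain w where "w \<in> carrier W" using W by (auto simp: is_structure_def)
        then show ?thesis by (cases "sat W (\<lambda>v. e v i) (All x \<phi>)") auto
      qed
      then obtain a where a: "\<And>i. a i \<in> carrier W"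
        "\<And>i. \<not> sat W (\<lambda>v. e v i) (All x \<phi>) \<Longrightarrow> \<not> sat W ((\<lambda>v. e v i)(x := a i)) \<phi>"
        by metis
      then have range: "range a \<subseteq> carrier W" by auto
      have "eventually (\<lambda>i. sat W ((\<lambda>v. e v i)(x := canon a i)) \<phi>) U"
        using all IH[OF canon(3)[OF range]] canon(3)[OF range] by simp
      with fails canon(2)[OF range] have "eventually (\<lambda>i. False) U"
      proof eventually_elim
        case (elim i)
        then show ?case using a(2)[of i] by metis
      qed
      then show False using proper by (simp add: trivial_limit_def)
    qed
  next
    assume "eventually (\<lambda>i. sat W (\<lambda>v. e v i) (All x \<phi>)) U"
    then have "eventually (\<lambda>i. sat W ((\<lambda>v. e v i)(x := c i)) \<phi>) U" if "c \<in> classes" for c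
      using classes_in_carrier[OF that] by (auto elim: eventually_mono)
    then show "sat upower e (All x \<phi>)" using IH by simp
  qed
qed

lemma is_model_upower:
  assumes "is_model L T W" and "\<forall>\<phi>\<in>T. wf_fm L \<phi>"
  shows "is_model L T upower"
  unfolding is_model_def valid_in_def
proof (intro conjI ballI allI impI)
  fix \<phi> and e :: "nat \<Rightarrow> nat \<Rightarrow> 'a"
  assume "\<phi> \<in> T" and "range e \<subseteq> carrier upower"
  moreover from this have "sat W (\<lambda>v. e v i) \<phi>" for i
    using assms(1) classes_in_carrier unfolding is_model_def valid_in_def carrier_upower
    by (metis (no_types, lifting) image_subset_iff range_subsetD)
  ultimately show "sat upower e \<phi>"
    using sat_upower_iff[of e \<phi>] assms(2) by simp
qed (rule is_structure_upower)

lemma infinite_upower: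
  assumes "infinite (carrier W)"
  shows "infinite (carrier upower)"
proof -
  have range: "range (\<lambda>_::nat. w) \<subseteq> carrier W" if "w \<in> carrier W" for w
    using that by auto
  have "inj_on (\<lambda>w. canon (\<lambda>_. w)) (carrier W)"
  proof (rule inj_onI)
    fix v w
    assume vw: "v \<in> carrier W" "w \<in> carrier W" "canon (\<lambda>_. v) = canon (\<lambda>_. w)"
    have "eventually (\<lambda>i::nat. v = w) U"
      using canon(2)[OF range[OF vw(1)]] canon(2)[OF range[OF vw(2)]] unfolding vw(3)
      by eventually_elim simp
    then show "v = w" using proper by (simp add: eventually_const)
  qed
  moreover have "(\<lambda>w. canon (\<lambda>_. w)) ` carrier W \<subseteq> classes"
    using canon(3)[OF range] by blast
  ultimately show ?thesis
    using assms finite_subset finite_imageD by (metis carrier_upower)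
qed

text \<open>A countable finitely realized type is realized: in coordinate \<open>i\<close> one realizes as many of the
  first \<open>i\<close> formulas as possible, and freeness of \<open>U\<close> makes each formula true almost everywhere.\<close>

lemma upower_countably_saturated:
  fixes \<psi> :: "nat \<Rightarrow> ('f, 'r) fm"
  assumes e: "range e \<subseteq> classes" and wf: "\<And>m. wf_fm L (\<psi> m)"
    and fin: "\<And>n. \<exists>d\<in>classes. \<forall>m<n. sat upower (e(x := d)) (\<psi> m)"
  shows "\<exists>d\<in>classes. \<forall>m. sat upower (e(x := d)) (\<psi> m)"
proof -
  define S where "S i m a \<longleftrightarrow> sat W ((\<lambda>v. e v i)(x := a)) (\<psi> m)" for i m a
  have upd: "(\<lambda>v. (e(x := c)) v i) = (\<lambda>v. e v i)(x := c i)" for c i by auto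
  have los: "sat upower (e(x := c)) (\<psi> m) \<longleftrightarrow> eventually (\<lambda>i. S i m (c i)) U" if "c \<in> classes" for c m
  proof -
    have "range (e(x := c)) \<subseteq> classes" using e that by auto
    then show ?thesis using sat_upower_iff[of "e(x := c)"] wf unfolding upd S_def by simp
  qed
  define realizable where "realizable i n \<longleftrightarrow> (\<exists>b\<in>carrier W. \<forall>m<n. S i m b)" for i n
  \<comment> \<open>A realization of the longest realizable initial segment realizes all shorter ones.\<close>
  have best: "\<exists>a\<in>carrier W. \<forall>n\<le>N. realizable i n \<longrightarrow> (\<forall>m<n. S i m a)" for i N
  proof (induction N)
    case 0
    then show ?case using W by (auto simp: is_structure_def)
  next
    case (Suc N)
    show ?case
    proof (cases "realizable i (Suc N)")
      case True
      then obtain b where "b \<in> carrier W" "\<forall>m<Suc N. S i m b" by (auto simp: realizable_def)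
      then show ?thesis by (intro bexI[of _ b]) auto
    next
      case False
      then show ?thesis using Suc by (metis le_Suc_eq)
    qed
  qed
  define a where "a i = (SOME a. a \<in> carrier W \<and> (\<forall>n\<le>i. realizable i n \<longrightarrow> (\<forall>m<n. S i m a)))" for i
  have a': "a i \<in> carrier W \<and> (\<forall>n\<le>i. realizable i n \<longrightarrow> (\<forall>m<n. S i m (a i)))" for i
    unfolding a_def by (rule someI_ex) (use best[of i i] in blast)
  then have range: "range a \<subseteq> carrier W" by (simp add: image_subset_iff)
  have "sat upower (e(x := canon a)) (\<psi> m)" for m
  proof -
    from fin[of "Suc m"] obtain d
      where d: "d \<in> classes" "\<forall>k<Suc m. sat upower (e(x := d)) (\<psi> k)" by blast
    have "eventually (\<lambda>i. \<forall>k\<in>{..<Suc m}. S i k (d i)) U"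
      using d(2) los[OF d(1)] by (intro eventually_ball_finite) simp_all
    moreover have "eventually (\<lambda>i. Suc m \<le> i) U"
      using free eventually_ge_at_top by (rule filter_leD)
    ultimately have "eventually (\<lambda>i. S i m (canon a i)) U"
      using canon(2)[OF range]
    proof eventually_elim
      case (elim i)
      then have "realizable i (Suc m)"
        unfolding realizable_def using classes_in_carrier[OF d(1)] by blast
      then have "S i m (a i)" using a'[of i] elim(2) by blast
      then show ?case using elim(3) by simp
    qed
    then show ?thesis using los[OF canon(3)[OF range]] by simp
  qed
  then show ?thesis using canon(3)[OF range] by blast
qed



end


section \<open>Homogeneous models\<close>

definition homogeneous :: "('f, 'r) language \<Rightarrow> ('f, 'r, 'a) struct \<Rightarrow> bool" where
  "homogeneous L M \<longleftrightarrow> (\<forall>as bs. set as \<subseteq> carrier M \<and> set bs \<subseteq> carrier M \<and> same_type L M as M bs \<longrightarrow>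
     (\<forall>c\<in>carrier M. \<exists>d\<in>carrier M. same_type L M (as @ [c]) M (bs @ [d])))"

lemma homogeneousD:
  "homogeneous L M \<Longrightarrow> set as \<subseteq> carrier M \<Longrightarrow> set bs \<subseteq> carrier M \<Longrightarrow> same_type L M as M bs \<Longrightarrow>
    c \<in> carrier M \<Longrightarrow> \<exists>d\<in>carrier M. same_type L M (as @ [c]) M (bs @ [d])"
  by (simp add: homogeneous_def)

lemma sat_snoc:
  "free_vars \<phi> \<subseteq> {..<Suc (length as)} \<Longrightarrow>
    sat M (\<lambda>i. (as @ [c]) ! i) \<phi> \<longleftrightarrow> sat M ((pad N as)(length as := c)) \<phi>"
  by (rule sat_cong) (auto simp: nth_append pad_def less_Suc_eq)

fun conj_fm :: "('f, 'r) fm list \<Rightarrow> ('f, 'r) fm" where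
  "conj_fm [] = neg Bot"
| "conj_fm (\<phi> # \<Phi>) = neg (Imp \<phi> (neg (conj_fm \<Phi>)))"

lemma sat_conj_fm [simp]: "sat M e (conj_fm \<Phi>) \<longleftrightarrow> (\<forall>\<phi>\<in>set \<Phi>. sat M e \<phi>)"
  by (induction \<Phi>) auto

lemma wf_conj_fm [simp]: "wf_fm L (conj_fm \<Phi>) \<longleftrightarrow> (\<forall>\<phi>\<in>set \<Phi>. wf_fm L \<phi>)"
  by (induction \<Phi>) auto

lemma free_vars_conj_fm [simp]: "free_vars (conj_fm \<Phi>) = (\<Union>\<phi>\<in>set \<Phi>. free_vars \<phi>)"
  by (induction \<Phi>) auto

text \<open>The type of \<open>c\<close> over \<open>as\<close>, transferred to \<open>bs\<close>, is finitely realized: that finitely many of its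
  formulas have a common solution is itself expressed by a formula, which holds of \<open>as\<close> and hence
  of \<open>bs\<close>. Saturation realizes all of it.\<close>

lemma (in ultrapower) homogeneous_upower:
  assumes L: "countable_language L"
  shows "homogeneous L upower"
  unfolding homogeneous_def
proof (intro allI impI ballI)
  fix as bs c
  assume *: "set as \<subseteq> carrier upower \<and> set bs \<subseteq> carrier upower \<and> same_type L upower as upower bs"
    and c: "c \<in> carrier upower"
  define k where "k = length as"
  have len: "length bs = k" using * by (simp add: same_type_def k_def)
  define e e' where "e = pad upower as" and "e' = pad upower bs"
  have e: "range e' \<subseteq> classes"
    using range_pad[OF is_structure_upower] * by (auto simp: e'_def)
  define F where "F = {\<phi>. wf_fm L \<phi> \<and> free_vars \<phi> \<subseteq> {..<Suc k}}"
  have F: "countable F" "F \<noteq> {}"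
  proof -
    show "countable F"
      using countable_formulas[OF L] by (rule countable_subset[rotated]) (auto simp: F_def)
    have "Bot \<in> F" by (simp add: F_def)
    then show "F \<noteq> {}" by blast
  qed
  \<comment> \<open>An enumeration of the type of \<open>c\<close>: of each formula and its negation, the one that \<open>c\<close>
    satisfies.\<close>
  define \<psi> where "\<psi> m = (let \<phi> = from_nat_into F m in
    if sat upower (e(k := c)) \<phi> then \<phi> else neg \<phi>)" for m
  have \<psi>: "wf_fm L (\<psi> m)" "free_vars (\<psi> m) \<subseteq> {..<Suc k}" "sat upower (e(k := c)) (\<psi> m)" for m
    using from_nat_into[OF F(2), of m] by (simp_all add: \<psi>_def Let_def F_def)
  have "\<exists>d\<in>classes. \<forall>m<n. sat upower (e'(k := d)) (\<psi> m)" for n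
  proof -
    \<comment> \<open>A formula about the first \<open>k\<close> variables saying that the first \<open>n\<close> formulas have a common
      solution.\<close>
    define \<chi> where "\<chi> = ex k (conj_fm (map \<psi> [0..<n]))"
    have \<chi>: "wf_fm L \<chi>" "free_vars \<chi> \<subseteq> {..<k}"
      using \<psi>(1,2) by (fastforce simp: \<chi>_def less_Suc_eq)+
    have "sat upower e \<chi>"
      using \<psi>(3) c by (auto simp: \<chi>_def)
    then have "sat upower e' \<chi>"
      using * \<chi> sat_pad[of \<chi> as upower upower] sat_pad[of \<chi> bs upower upower]
      by (simp add: same_type_def e_def e'_def k_def)
    then obtain d where "d \<in> classes" "\<forall>\<phi>\<in>set (map \<psi> [0..<n]). sat upower (e'(k := d)) \<phi>"
      unfolding \<chi>_def by auto
    then show ?thesis by (intro bexI[of _ d]) simp_all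
  qed
  then obtain d where d: "d \<in> classes" "\<And>m. sat upower (e'(k := d)) (\<psi> m)"
    using upower_countably_saturated[where \<psi> = \<psi>, OF e \<psi>(1), of k] by blast
  have "sat upower (e(k := c)) \<phi> \<longleftrightarrow> sat upower (e'(k := d)) \<phi>" if "\<phi> \<in> F" for \<phi>
  proof -
    from from_nat_into_surj[OF F(1) that] obtain m where "\<phi> = from_nat_into F m" by metis
    then show ?thesis using d(2)[of m] by (auto simp: \<psi>_def Let_def split: if_splits)
  qed
  then have "same_type L upower (as @ [c]) upower (bs @ [d])"
    using len sat_snoc[of _ as upower c upower] sat_snoc[of _ bs upower d upower]
    by (simp add: same_type_def F_def e_def e'_def k_def)
  then show "\<exists>d\<in>carrier upower. same_type L upower (as @ [c]) upower (bs @ [d])"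
    using d(1) by auto
qed

lemma isomorphic_homogeneous:
  assumes M: "is_structure L M" and "isomorphic L M N" and N: "homogeneous L N"
  shows "homogeneous L M"
  unfolding homogeneous_def
proof (intro allI impI ballI)
  fix as bs c
  assume *: "set as \<subseteq> carrier M \<and> set bs \<subseteq> carrier M \<and> same_type L M as M bs"
    and c: "c \<in> carrier M"
  obtain \<pi> where \<pi>: "is_embedding L M N \<pi>" "\<pi> ` carrier M = carrier N"
    using assms(2) by (auto simp: isomorphic_def)
  have type: "same_type L M xs N (map \<pi> xs)" if "set xs \<subseteq> carrier M" for xs
    using elementary_map_same_type[OF M isomorphism_elementary_map[OF M \<pi>] that] .
  have "same_type L N (map \<pi> as) N (map \<pi> bs)"
    using type * same_type_sym same_type_trans by metis
  moreover have "set (map \<pi> as) \<subseteq> carrier N" "set (map \<pi> bs) \<subseteq> carrier N" "\<pi> c \<in> carrier N"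
    using * c \<pi>(2) by auto
  ultimately obtain d' where d': "d' \<in> carrier N"
    "same_type L N (map \<pi> as @ [\<pi> c]) N (map \<pi> bs @ [d'])"
    using N unfolding homogeneous_def by blast
  obtain d where d: "d \<in> carrier M" "d' = \<pi> d" using d'(1) \<pi>(2) by blast
  have "same_type L M (as @ [c]) N (map \<pi> as @ [\<pi> c])"
    "same_type L M (bs @ [d]) N (map \<pi> bs @ [d'])"
    using type[of "as @ [c]"] type[of "bs @ [d]"] * c d by simp_all
  then have "same_type L M (as @ [c]) M (bs @ [d])"
    using d'(2) same_type_sym same_type_trans by metis
  then show "\<exists>d\<in>carrier M. same_type L M (as @ [c]) M (bs @ [d])" using d(1) by blast
qed

text \<open>Closing under a choice of extension witnesses, one for each triple of two tuples and an
  element, makes the substructure homogeneous, because it sees the same types as \<open>M\<close>.\<close>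

lemma countable_homogeneous_substructure:
  assumes L: "countable_language L" and M: "is_structure L M" and hom: "homogeneous L M"
    and A: "countable A" "A \<subseteq> carrier M"
  obtains B where "countable B" "A \<subseteq> B" "B \<subseteq> carrier M"
    "is_structure L (substructure L M B)"
    "elementary_map L (substructure L M B) M (\<lambda>x\<in>B. x)"
    "homogeneous L (substructure L M B)"
proof -
  define wit where "wit as bs c = (SOME d. d \<in> carrier M \<and>
    ((\<exists>d\<in>carrier M. same_type L M (as @ [c]) M (bs @ [d])) \<longrightarrow> same_type L M (as @ [c]) M (bs @ [d])))"
    for as bs c
  have wit: "wit as bs c \<in> carrier M \<and>
    ((\<exists>d\<in>carrier M. same_type L M (as @ [c]) M (bs @ [d])) \<longrightarrow>
      same_type L M (as @ [c]) M (bs @ [wit as bs c]))" for as bs c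
  proof -
    obtain w where "w \<in> carrier M" using M by (auto simp: is_structure_def)
    then have "\<exists>d. d \<in> carrier M \<and>
      ((\<exists>d\<in>carrier M. same_type L M (as @ [c]) M (bs @ [d])) \<longrightarrow>
        same_type L M (as @ [c]) M (bs @ [d]))" by blast
    from someI_ex[OF this] show ?thesis unfolding wit_def .
  qed
  \<comment> \<open>The list \<open>xs\<close> is read as \<open>as @ bs @ [c]\<close> with \<open>as\<close> and \<open>bs\<close> of length \<open>k\<close>.\<close>
  define H where "H xs = (\<lambda>k. wit (take k xs) (take k (drop k xs)) (last xs)) ` (UNIV :: nat set)" for xs
  have H: "countable (H xs) \<and> H xs \<subseteq> carrier M" for xs
    using wit[THEN conjunct1] by (simp add: H_def image_subset_iff)
  obtain B where B: "countable B" "A \<subseteq> B" "B \<subseteq> carrier M"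
    "is_structure L (substructure L M B)"
    "elementary_map L (substructure L M B) M (\<lambda>x\<in>B. x)"
    and closed: "\<And>xs. set xs \<subseteq> B \<Longrightarrow> H xs \<subseteq> B"
    by (rule elementary_substructure_closed_under[where H = H, OF L M A H]) (rule that)
  let ?S = "substructure L M B"
  have type: "same_type L ?S xs M xs" if "set xs \<subseteq> B" for xs
    using elementary_map_same_type[OF B(4,5), of xs] that by (simp add: map_restrict_eq)
  have "homogeneous L ?S"
    unfolding homogeneous_def carrier_substructure
  proof (intro allI impI ballI)
    fix as bs c
    assume *: "set as \<subseteq> B \<and> set bs \<subseteq> B \<and> same_type L ?S as ?S bs" and c: "c \<in> B"
    define d where "d = wit as bs c"
    have len: "length as = length bs" using * by (simp add: same_type_def)
    have "d = (\<lambda>k. wit (take k (as @ bs @ [c])) (take k (drop k (as @ bs @ [c]))) (last (as @ bs @ [c])))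
        (length as)"
      using len by (simp add: d_def)
    then have "d \<in> H (as @ bs @ [c])" unfolding H_def by (rule image_eqI) simp
    moreover have "set (as @ bs @ [c]) \<subseteq> B" using * c by simp
    ultimately have d: "d \<in> B" using closed by blast
    have "same_type L M as M bs"
      using type[of as] type[of bs] * by (metis same_type_sym same_type_trans)
    moreover have "set as \<subseteq> carrier M" "set bs \<subseteq> carrier M" "c \<in> carrier M"
      using * c B(3) by blast+
    ultimately have "\<exists>d\<in>carrier M. same_type L M (as @ [c]) M (bs @ [d])"
      using homogeneousD[OF hom] by simp
    then have "same_type L M (as @ [c]) M (bs @ [d])"
      using wit[of as bs c] by (simp add: d_def)
    moreover have "same_type L ?S (as @ [c]) M (as @ [c])" "same_type L ?S (bs @ [d]) M (bs @ [d])"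
      using * c d by (simp_all add: type)
    ultimately have "same_type L ?S (as @ [c]) ?S (bs @ [d])"
      using same_type_sym same_type_trans by metis
    then show "\<exists>d\<in>B. same_type L ?S (as @ [c]) ?S (bs @ [d])" using d by blast
  qed
  then show thesis using that B by blast
qed

lemma is_model_elementary_substructure:
  assumes "is_model L T M" and "\<forall>\<phi>\<in>T. wf_fm L \<phi>" and "is_structure L N"
    and "elementary_map L N M \<pi>"
  shows "is_model L T N"
  using assms elementary_map_valid_in unfolding is_model_def by metis

text \<open>Saturated ultrapowers are homogeneous, and homogeneity passes to a suitable countable
  elementary substructure. By categoricity this substructure is the given model.\<close>

lemma categorical_homogeneous:
  assumes L: "countable_language L" and cat: "aleph0_categorical L T"
    and wf: "\<forall>\<phi>\<in>T. wf_fm L \<phi>"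
    and mod: "is_model L T W" "infinite (carrier W)" "countable (carrier W)"
  shows "homogeneous L W"
proof -
  obtain U :: "nat filter" where "U \<noteq> bot" "U \<le> sequentially"
    "\<And>P. eventually P U \<or> eventually (\<lambda>i. \<not> P i) U"
    by (rule free_ultrafilter_exists) (rule that)
  then interpret ultrapower U L W
    using mod(1) by unfold_locales (auto simp: is_model_def)
  obtain A where A: "countable A" "infinite A" "A \<subseteq> carrier upower"
    using infinite_countable_subset'[OF infinite_upower[OF mod(2)]] by blast
  obtain B where B: "countable B" "A \<subseteq> B" "B \<subseteq> carrier upower"
    "is_structure L (substructure L upower B)"
    "elementary_map L (substructure L upower B) upower (\<lambda>x\<in>B. x)"
    "homogeneous L (substructure L upower B)"
    by (rule countable_homogeneous_substructure[OF L is_structure_upower homogeneous_upower[OF L] A(1,3)])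
      (rule that)
  have "isomorphic L W (substructure L upower B)"
  proof (rule countable_models_isomorphic[OF cat wf mod])
    show "is_model L T (substructure L upower B)"
      using is_model_elementary_substructure[OF is_model_upower[OF mod(1) wf] wf B(4,5)] .
    show "infinite (carrier (substructure L upower B))"
      using A(2) B(2) by (auto dest: finite_subset)
  qed (simp add: B(1))
  then show ?thesis
    using isomorphic_homogeneous mod(1) B(6) by (auto simp: is_model_def)
qed


section \<open>Infinite models of a categorical theory\<close>

text \<open>A countable elementary substructure around \<open>A\<close> is an infinite model of \<open>T\<close>, hence a copy of \<open>W\<close>.\<close>

lemma countable_elementary_cover:
  assumes L: "countable_language L" and cat: "aleph0_categorical L T"
    and wf: "\<forall>\<phi>\<in>T. wf_fm L \<phi>"
    and W: "is_model L T W" "infinite (carrier W)" "countable (carrier W)"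
    and M: "is_model L T M" "infinite (carrier M)"
    and A: "countable A" "A \<subseteq> carrier M"
  obtains g where "is_embedding L W M g" "elementary_map L W M g" "A \<subseteq> g ` carrier W"
proof -
  have st: "is_structure L M" "is_structure L W" using M W by (simp_all add: is_model_def)
  \<comment> \<open>An infinite set is put into the substructure, as categoricity concerns only infinite models.\<close>
  obtain A' where A': "countable A'" "infinite A'" "A' \<subseteq> carrier M"
    using infinite_countable_subset'[OF M(2)] by blast
  then have "countable (A \<union> A')" "A \<union> A' \<subseteq> carrier M" using A by simp_all
  note LS = elementary_substructure_closed_under[where H = "\<lambda>_. {}", OF L st(1) this]
  obtain B where B: "countable B" "A \<union> A' \<subseteq> B" "B \<subseteq> carrier M"
    "is_structure L (substructure L M B)"
    "is_embedding L (substructure L M B) M (\<lambda>x\<in>B. x)"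
    "elementary_map L (substructure L M B) M (\<lambda>x\<in>B. x)"
    by (rule LS) (simp, rule that)
  let ?S = "substructure L M B"
  have "isomorphic L W ?S"
  proof (rule countable_models_isomorphic[OF cat wf W])
    show "is_model L T ?S"
      using is_model_elementary_substructure[OF M(1) wf B(4,6)] .
    show "infinite (carrier ?S)" using A'(2) B(2) by (auto dest: finite_subset)
  qed (simp add: B(1))
  then obtain \<pi> where \<pi>: "is_embedding L W ?S \<pi>" "\<pi> ` carrier W = B"
    by (auto simp: isomorphic_def)
  let ?g = "compose (carrier W) (\<lambda>x\<in>B. x) \<pi>"
  have g: "?g x = \<pi> x" if "x \<in> carrier W" for x
    using that \<pi>(2) by (auto simp: compose_def)
  show thesis
  proof (rule that)
    show "is_embedding L W M ?g" by (rule embedding_compose[OF \<pi>(1) B(5) st(2)])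
    have "elementary_map L W ?S \<pi>"
      using isomorphism_elementary_map[OF st(2) \<pi>(1)] \<pi>(2) by simp
    then show "elementary_map L W M ?g"
      using B(6) by (rule elementary_map_comp) (simp add: compose_def)
    have "?g ` carrier W = B" using g \<pi>(2) by (simp cong: image_cong)
    then show "A \<subseteq> ?g ` carrier W" using B(2) by simp
  qed
qed

text \<open>An assignment has a countable range, so it lives in an elementary copy of \<open>W\<close>.\<close>

lemma infinite_models_valid_in:
  assumes L: "countable_language L" and cat: "aleph0_categorical L T"
    and wf: "\<forall>\<phi>\<in>T. wf_fm L \<phi>"
    and W: "is_model L T W" "infinite (carrier W)" "countable (carrier W)"
    and M: "is_model L T M" "infinite (carrier M)"
    and \<phi>: "wf_fm L \<phi>" "valid_in W \<phi>"
  shows "valid_in M \<phi>"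
  unfolding valid_in_def
proof (intro allI impI)
  fix e :: "nat \<Rightarrow> _"
  assume e: "range e \<subseteq> carrier M"
  have "countable (range e)" by simp
  from countable_elementary_cover[OF L cat wf W M this e]
  obtain g where g: "elementary_map L W M g" "range e \<subseteq> g ` carrier W" by metis
  define e' where "e' = inv_into (carrier W) g \<circ> e"
  have e': "range e' \<subseteq> carrier W" "g \<circ> e' = e"
    using g(2) by (auto simp: e'_def fun_eq_iff inv_into_into f_inv_into_f image_subset_iff)
  then have "sat W e' \<phi>" using \<phi>(2) by (simp add: valid_in_def)
  then show "sat M e \<phi>" using g(1) e' \<phi>(1) unfolding elementary_map_def by metis
qed

text \<open>Model completeness: embeddings preserve the quantifier-free formula to which a given formula is
  equivalent. Quantifier elimination speaks of models on the type of formulas only; the equivalence is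
  read off there from one countable model and holds then in all infinite models.\<close>

lemma embedding_elementary_map:
  fixes L :: "('f, 'r) language"
  assumes L: "countable_language L" and cat: "aleph0_categorical L T"
    and wf: "\<forall>\<phi>\<in>T. wf_fm L \<phi>" and qe: "has_qe L T"
    and M: "is_model L T M" "infinite (carrier M)"
    and N: "is_model L T N" "infinite (carrier N)"
    and emb: "is_embedding L M N \<pi>"
  shows "elementary_map L M N \<pi>"
  unfolding elementary_map_def
proof (intro conjI allI impI)
  show "\<pi> ` carrier M \<subseteq> carrier N" using embedding_in_carrier[OF emb] by blast
next
  fix \<phi> and e :: "nat \<Rightarrow> _"
  assume *: "wf_fm L \<phi> \<and> range e \<subseteq> carrier M"
  obtain W0 :: "('f, 'r, nat) struct" where W0: "is_model L T W0" "infinite (carrier W0)"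
    using cat by (auto simp: aleph0_categorical_def)
  \<comment> \<open>An injection that exists for every language.\<close>
  define h :: "nat \<Rightarrow> ('f, 'r) fm" where "h n = Eq (Var n) (Var n)" for n
  have h: "inj_on h (carrier W0)" by (simp add: inj_on_def h_def)
  have st: "is_structure L W0" using W0 by (simp add: is_model_def)
  let ?W = "copy L W0 h"
  have W: "is_model L T ?W"
    using isomorphic_is_model[OF W0(1) is_structure_copy[OF st] isomorphic_copy[OF st h] wf] .
  have inf: "infinite (carrier ?W)" "countable (carrier ?W)"
    using W0(2) h by (simp_all add: copy_def finite_image_iff)
  obtain \<psi> where \<psi>: "wf_fm L \<psi>" "qfree \<psi>"
    and eq: "\<And>e. range e \<subseteq> carrier ?W \<Longrightarrow> sat ?W e \<phi> \<longleftrightarrow> sat ?W e \<psi>"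
    using qe * W unfolding has_qe_def by metis
  then have valid: "valid_in ?W (Imp \<phi> \<psi>)" "valid_in ?W (Imp \<psi> \<phi>)"
    by (simp_all add: valid_in_def)
  have wfs: "wf_fm L (Imp \<phi> \<psi>)" "wf_fm L (Imp \<psi> \<phi>)" using * \<psi> by simp_all
  have "valid_in M (Imp \<phi> \<psi>)" "valid_in M (Imp \<psi> \<phi>)" "valid_in N (Imp \<phi> \<psi>)" "valid_in N (Imp \<psi> \<phi>)"
    using infinite_models_valid_in[OF L cat wf W inf M wfs(1) valid(1)]
      infinite_models_valid_in[OF L cat wf W inf M wfs(2) valid(2)]
      infinite_models_valid_in[OF L cat wf W inf N wfs(1) valid(1)]
      infinite_models_valid_in[OF L cat wf W inf N wfs(2) valid(2)] .
  moreover have "range (\<pi> \<circ> e) \<subseteq> carrier N" using * embedding_in_carrier[OF emb] by auto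
  ultimately have "sat M e \<phi> \<longleftrightarrow> sat M e \<psi>" "sat N (\<pi> \<circ> e) \<phi> \<longleftrightarrow> sat N (\<pi> \<circ> e) \<psi>"
    using * by (auto simp: valid_in_def)
  moreover have "sat M e \<psi> \<longleftrightarrow> sat N (\<pi> \<circ> e) \<psi>"
    using embedding_qfree[OF _ emb _ \<psi>] M(1) * by (simp add: is_model_def)
  ultimately show "sat M e \<phi> \<longleftrightarrow> sat N (\<pi> \<circ> e) \<phi>" by simp
qed


section \<open>Collapsing the infinite worlds\<close>

text \<open>What the bisimulation argument uses of the model theory: \<open>W\<close> is homogeneous and lies
  elementarily in every infinite world around any finite set, and embeddings between infinite
  worlds are elementary.\<close>

locale collapse =
  fixes L :: "('f, 'r) language" and \<M> :: "('f, 'r, 'a) system" and W :: "('f, 'r, 'a) struct"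
  assumes system: "potentialist_system L \<M>"
    and infinite_world: "\<exists>M\<in>worlds \<M>. infinite (carrier M)"
    and W: "is_structure L W" "infinite (carrier W)"
    and homogeneous: "homogeneous L W"
    and cover: "\<And>M A. M \<in> worlds \<M> \<Longrightarrow> infinite (carrier M) \<Longrightarrow> finite A \<Longrightarrow> A \<subseteq> carrier M \<Longrightarrow>
      \<exists>g. is_embedding L W M g \<and> elementary_map L W M g \<and> A \<subseteq> g ` carrier W"
    and elementary: "\<And>M \<pi> M'. (M, \<pi>, M') \<in> embs \<M> \<Longrightarrow> infinite (carrier M) \<Longrightarrow>
      elementary_map L M M' \<pi>"
begin

text \<open>An embedding of a finite world into \<open>W\<close> is admitted if some embedding of the system into an
  infinite world gives the tuples of the finite world the same types.\<close>

definition into_W :: "('f, 'r, 'a) struct \<Rightarrow> ('a \<Rightarrow> 'a) \<Rightarrow> bool" where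
  "into_W F \<rho> \<longleftrightarrow> F \<in> worlds \<M> \<and> finite (carrier F) \<and> is_embedding L F W \<rho> \<and>
     (\<exists>\<pi> M. (F, \<pi>, M) \<in> embs \<M> \<and> infinite (carrier M) \<and>
        (\<forall>xs. set xs \<subseteq> carrier F \<longrightarrow> same_type L M (map \<pi> xs) W (map \<rho> xs)))"

definition collapsed :: "('f, 'r, 'a) system" where
  "collapsed =
     \<lparr>worlds = insert W {M \<in> worlds \<M>. finite (carrier M)},
      embs = insert (W, \<lambda>x\<in>carrier W. x, W)
        ({(M, \<pi>, M'). (M, \<pi>, M') \<in> embs \<M> \<and> finite (carrier M')} \<union>
         {(M, \<pi>, M'). M' = W \<and> into_W M \<pi>})\<rparr>"

lemma worlds_collapsed: "worlds collapsed = insert W {M \<in> worlds \<M>. finite (carrier M)}"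
  by (simp add: collapsed_def)

lemma embs_collapsed:
  "(M, \<pi>, M') \<in> embs collapsed \<longleftrightarrow>
     M = W \<and> \<pi> = (\<lambda>x\<in>carrier W. x) \<and> M' = W \<or>
     (M, \<pi>, M') \<in> embs \<M> \<and> finite (carrier M') \<or>
     M' = W \<and> into_W M \<pi>"
  by (auto simp: collapsed_def)

lemma worlds_structure: "M \<in> worlds \<M> \<Longrightarrow> is_structure L M"
  using system by (simp add: potentialist_system_def)

lemma embs_world:
  assumes "(M, \<pi>, M') \<in> embs \<M>"
  shows "M \<in> worlds \<M>" "M' \<in> worlds \<M>" "is_embedding L M M' \<pi>"
  using assms system unfolding potentialist_system_def by blast+

lemma embs_compose:
  "(M, \<pi>, M') \<in> embs \<M> \<Longrightarrow> (M', \<rho>, M'') \<in> embs \<M> \<Longrightarrow> (M, compose (carrier M) \<rho> \<pi>, M'') \<in> embs \<M>"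
  using system unfolding potentialist_system_def by blast

lemma embs_identity: "M \<in> worlds \<M> \<Longrightarrow> (M, \<lambda>x\<in>carrier M. x, M) \<in> embs \<M>"
  using system by (simp add: potentialist_system_def)

lemma embs_finite:
  assumes "(M, \<pi>, M') \<in> embs \<M>" and "finite (carrier M')"
  shows "finite (carrier M)"
  using embedding_finite[OF embs_world(3)[OF assms(1)] assms(2)] .

text \<open>If \<open>\<sigma>\<close> witnesses that \<open>\<rho>\<close> is admitted, then the composition of \<open>\<sigma>\<close> and \<open>\<pi>\<close>, an embedding of the
  system, witnesses this for the composition of \<open>\<rho>\<close> and \<open>\<pi>\<close>.\<close>

lemma into_W_compose:
  assumes "(M, \<pi>, M') \<in> embs \<M>" and "into_W M' \<rho>"
  shows "into_W M (compose (carrier M) \<rho> \<pi>)"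
proof -
  obtain \<sigma> P where P: "(M', \<sigma>, P) \<in> embs \<M>" "infinite (carrier P)"
    and type: "\<And>xs. set xs \<subseteq> carrier M' \<Longrightarrow> same_type L P (map \<sigma> xs) W (map \<rho> xs)"
    using assms(2) by (auto simp: into_W_def)
  note M = embs_world[OF assms(1)]
  have comp: "map (compose (carrier M) \<tau> \<pi>) xs = map \<tau> (map \<pi> xs)" if "set xs \<subseteq> carrier M"
    for \<tau> :: "'a \<Rightarrow> 'a" and xs
    using that by (auto simp: compose_def)
  have "same_type L P (map (compose (carrier M) \<sigma> \<pi>) xs) W (map (compose (carrier M) \<rho> \<pi>) xs)"
    if xs: "set xs \<subseteq> carrier M" for xs
  proof -
    have "set (map \<pi> xs) \<subseteq> carrier M'" using xs embedding_in_carrier[OF M(3)] by auto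
    then show ?thesis using type comp[OF xs] by metis
  qed
  moreover have "is_embedding L M W (compose (carrier M) \<rho> \<pi>)"
    using assms(2) worlds_structure[OF M(1)]
    by (intro embedding_compose[OF M(3)]) (simp_all add: into_W_def)
  moreover have "finite (carrier M)"
    using embs_finite[OF assms(1)] assms(2) by (simp add: into_W_def)
  ultimately show ?thesis
    using M(1) embs_compose[OF assms(1) P(1)] P(2) unfolding into_W_def by blast
qed

text \<open>Embeddings into finite worlds start in finite worlds, and \<open>W\<close> admits the identity only. So in
  a composition either the second embedding is the identity of \<open>W\<close>, or the first is an embedding of
  the original system between finite worlds.\<close>

lemma potentialist_system_collapsed: "potentialist_system L collapsed"
  unfolding potentialist_system_def
proof (intro conjI allI ballI impI)
  fix M
  assume "M \<in> worlds collapsed"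
  then show "is_structure L M" "(M, \<lambda>x\<in>carrier M. x, M) \<in> embs collapsed"
    using W worlds_structure embs_identity by (auto simp: worlds_collapsed embs_collapsed)
next
  fix M \<pi> M'
  assume "(M, \<pi>, M') \<in> embs collapsed"
  then consider "M = W" "\<pi> = (\<lambda>x\<in>carrier W. x)" "M' = W"
    | "(M, \<pi>, M') \<in> embs \<M>" "finite (carrier M')" | "M' = W" "into_W M \<pi>"
    unfolding embs_collapsed by blast
  then have "M \<in> worlds collapsed \<and> M' \<in> worlds collapsed \<and> is_embedding L M M' \<pi>"
  proof cases
    case 1
    then show ?thesis using identity_embedding W by (simp add: worlds_collapsed)
  next
    case 2
    then show ?thesis using embs_world[OF 2(1)] embs_finite[OF 2] by (simp add: worlds_collapsed)
  next
    case 3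
    then show ?thesis by (simp add: worlds_collapsed into_W_def)
  qed
  then show "M \<in> worlds collapsed" "M' \<in> worlds collapsed" "is_embedding L M M' \<pi>" by simp_all
next
  fix M \<pi> M' \<rho> M''
  assume *: "(M, \<pi>, M') \<in> embs collapsed \<and> (M', \<rho>, M'') \<in> embs collapsed"
  have id: "compose (carrier M) (\<lambda>x\<in>carrier W. x) \<pi> = \<pi>" if "is_embedding L M W \<pi>"
    using that unfolding is_embedding_def by (intro Id_compose) (auto simp: PiE_iff)
  consider "M' = W" "M'' = W" "\<rho> = (\<lambda>x\<in>carrier W. x)"
    | "finite (carrier M')" "(M, \<pi>, M') \<in> embs \<M>" "(M', \<rho>, M'') \<in> embs \<M>" "finite (carrier M'')"
    | "finite (carrier M')" "(M, \<pi>, M') \<in> embs \<M>" "M'' = W" "into_W M' \<rho>"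
  proof -
    have "infinite (carrier M')" if "M' = W" using W(2) that by simp
    moreover have "finite (carrier M')" if "(M', \<rho>, M'') \<in> embs \<M>" "finite (carrier M'')"
      using embs_finite that .
    moreover have "finite (carrier M')" if "into_W M' \<rho>" using that by (simp add: into_W_def)
    ultimately show thesis
      using that * unfolding embs_collapsed by argo
  qed
  then show "(M, compose (carrier M) \<rho> \<pi>, M'') \<in> embs collapsed"
  proof cases
    case 1
    have "is_embedding L M W \<pi>"
      using * 1(1) identity_embedding[OF W(1)] embs_world(3) unfolding embs_collapsed into_W_def by metis
    then show ?thesis using id * 1 by metis
  next
    case 2
    then show ?thesis using embs_compose by (simp add: embs_collapsed)
  next
    case 3
    then show ?thesis using into_W_compose by (simp add: embs_collapsed)
  qed
qed

text \<open>The tuple \<open>as\<close> and the new element are pulled back to \<open>W\<close> along an elementary embedding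
  that covers them; there homogeneity applies.\<close>

lemma same_type_extend:
  assumes M: "M \<in> worlds \<M>" "infinite (carrier M)" and as: "set as \<subseteq> carrier M"
    and bs: "set bs \<subseteq> carrier W" and type: "same_type L M as W bs"
  shows "c \<in> carrier M \<Longrightarrow> \<exists>d\<in>carrier W. same_type L M (as @ [c]) W (bs @ [d])"
    and "d \<in> carrier W \<Longrightarrow> \<exists>c\<in>carrier M. same_type L M (as @ [c]) W (bs @ [d])"
proof -
  have pull: "\<exists>as'. set as' \<subseteq> carrier W \<and> as = map g as'" if "set as \<subseteq> g ` carrier W" for g as
  proof (intro exI conjI)
    show "set (map (inv_into (carrier W) g) as) \<subseteq> carrier W"
      using that by (auto intro: inv_into_into)
    show "as = map g (map (inv_into (carrier W) g) as)"
      using that by (auto simp: f_inv_into_f subset_iff intro!: map_idI[symmetric])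
  qed
  {
    assume c: "c \<in> carrier M"
    obtain g where g: "elementary_map L W M g" "set (as @ [c]) \<subseteq> g ` carrier W"
      using cover[OF M, of "set (as @ [c])"] as c by auto
    obtain as' where as': "set as' \<subseteq> carrier W" "as = map g as'" using pull[of as g] g(2) by auto
    obtain c' where c': "c' \<in> carrier W" "c = g c'" using g(2) by auto
    have "same_type L W as' W bs"
      using elementary_map_same_type[OF W(1) g(1) as'(1)] type unfolding as'(2)
      by (rule same_type_trans)
    from homogeneousD[OF homogeneous as'(1) bs this c'(1)]
    obtain d where d: "d \<in> carrier W" "same_type L W (as' @ [c']) W (bs @ [d])" by blast
    have "same_type L W (as' @ [c']) M (as @ [c])"
      using elementary_map_same_type[OF W(1) g(1), of "as' @ [c']"] as' c' by simp
    then show "\<exists>d\<in>carrier W. same_type L M (as @ [c]) W (bs @ [d])"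
      using d same_type_sym same_type_trans by metis
  }
  {
    assume d: "d \<in> carrier W"
    obtain g where g: "elementary_map L W M g" "set as \<subseteq> g ` carrier W"
      using cover[OF M, of "set as"] as by auto
    obtain as' where as': "set as' \<subseteq> carrier W" "as = map g as'" using pull[of as g] g(2) by auto
    have "same_type L W as' W bs"
      using elementary_map_same_type[OF W(1) g(1) as'(1)] type unfolding as'(2)
      by (rule same_type_trans)
    from homogeneousD[OF homogeneous bs as'(1) same_type_sym[OF this] d]
    obtain c' where c': "c' \<in> carrier W" "same_type L W (bs @ [d]) W (as' @ [c'])" by blast
    have "same_type L W (as' @ [c']) M (as @ [g c'])"
      using elementary_map_same_type[OF W(1) g(1), of "as' @ [c']"] as' c' by simp
    then have "same_type L M (as @ [g c']) W (bs @ [d])"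
      using c'(2) same_type_sym same_type_trans by metis
    moreover have "g c' \<in> carrier M" using g(1) c'(1) by (auto simp: elementary_map_def)
    ultimately show "\<exists>c\<in>carrier M. same_type L M (as @ [c]) W (bs @ [d])" by blast
  }
qed

text \<open>An embedding of a finite world into an infinite world has its image in an elementary copy of
  \<open>W\<close>, and there it is an embedding into \<open>W\<close>.\<close>

lemma finite_world_into_W:
  assumes "(F, \<pi>, M) \<in> embs \<M>" and "finite (carrier F)" and "infinite (carrier M)"
  obtains \<rho> where "into_W F \<rho>"
    "\<And>xs. set xs \<subseteq> carrier F \<Longrightarrow> same_type L M (map \<pi> xs) W (map \<rho> xs)"
proof -
  note FM = embs_world[OF assms(1)]
  have "finite (\<pi> ` carrier F)" "\<pi> ` carrier F \<subseteq> carrier M"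
    using assms(2) embedding_in_carrier[OF FM(3)] by auto
  from cover[OF FM(2) assms(3) this]
  obtain g where g: "is_embedding L W M g" "elementary_map L W M g" "\<pi> ` carrier F \<subseteq> g ` carrier W"
    by blast
  obtain \<rho> where \<rho>: "is_embedding L F W \<rho>" "\<And>x. x \<in> carrier F \<Longrightarrow> g (\<rho> x) = \<pi> x"
    by (rule embedding_factor[OF worlds_structure[OF FM(1)] W(1) FM(3) g(1,3)]) (rule that)
  have type: "same_type L M (map \<pi> xs) W (map \<rho> xs)" if xs: "set xs \<subseteq> carrier F" for xs
  proof -
    have "set (map \<rho> xs) \<subseteq> carrier W" using xs embedding_in_carrier[OF \<rho>(1)] by auto
    from elementary_map_same_type[OF W(1) g(2) this]
    have "same_type L W (map \<rho> xs) M (map g (map \<rho> xs))" .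
    moreover have "map g (map \<rho> xs) = map \<pi> xs" using xs \<rho>(2) by auto
    ultimately show ?thesis using same_type_sym by metis
  qed
  show thesis
    by (rule that[OF _ type]) (use assms FM \<rho>(1) type in \<open>auto simp: into_W_def\<close>)
qed

text \<open>The bisimulation. The world \<open>W\<close> may itself be a world of the original system, and is then matched
  with itself by types, not by equality of tuples.\<close>

definition matching :: "((('f, 'r, 'a) struct \<times> 'a list) \<times> (('f, 'r, 'a) struct \<times> 'a list)) set" where
  "matching =
     {((M, as), (N, bs)). M \<in> worlds \<M> \<and> set as \<subseteq> carrier M \<and>
        (if finite (carrier M) then N = M \<and> bs = as
         else N = W \<and> set bs \<subseteq> carrier W \<and> same_type L M as W bs)}"

lemma matching_finite:
  "finite (carrier M) \<Longrightarrow>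
    ((M, as), (N, bs)) \<in> matching \<longleftrightarrow> M \<in> worlds \<M> \<and> set as \<subseteq> carrier M \<and> N = M \<and> bs = as"
  by (auto simp: matching_def)

lemma matching_infinite:
  "infinite (carrier M) \<Longrightarrow>
    ((M, as), (N, bs)) \<in> matching \<longleftrightarrow> M \<in> worlds \<M> \<and> set as \<subseteq> carrier M \<and> N = W \<and>
      set bs \<subseteq> carrier W \<and> same_type L M as W bs"
  by (auto simp: matching_def)

lemma matching_left_total:
  assumes "M \<in> worlds \<M>" and "set as \<subseteq> carrier M"
  shows "\<exists>N bs. N \<in> worlds collapsed \<and> set bs \<subseteq> carrier N \<and> ((M, as), (N, bs)) \<in> matching"
proof (cases "finite (carrier M)")
  case True
  then show ?thesis using assms by (auto simp: matching_finite worlds_collapsed)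
next
  case False
  from cover[OF assms(1) False _ assms(2)]
  obtain g where g: "elementary_map L W M g" "set as \<subseteq> g ` carrier W" by auto
  let ?bs = "map (inv_into (carrier W) g) as"
  have bs: "set ?bs \<subseteq> carrier W" using g(2) by (auto intro: inv_into_into)
  moreover have "map g ?bs = as" using g(2) by (auto simp: f_inv_into_f subset_iff intro!: map_idI)
  then have "same_type L M as W ?bs"
    using elementary_map_same_type[OF W(1) g(1) bs] same_type_sym by metis
  ultimately have "((M, as), (W, ?bs)) \<in> matching"
    using assms False by (simp add: matching_infinite)
  then show ?thesis using bs worlds_collapsed by blast
qed

lemma matching_right_total:
  assumes "N \<in> worlds collapsed" and "set bs \<subseteq> carrier N"
  shows "\<exists>M as. M \<in> worlds \<M> \<and> set as \<subseteq> carrier M \<and> ((M, as), (N, bs)) \<in> matching"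
proof (cases "N = W")
  case False
  then show ?thesis using assms by (auto simp: matching_finite worlds_collapsed)
next
  case True
  obtain M where M: "M \<in> worlds \<M>" "infinite (carrier M)" using infinite_world by blast
  from cover[OF M, of "{}"] obtain g where g: "elementary_map L W M g" by auto
  have bs: "set bs \<subseteq> carrier W" using assms(2) True by simp
  have "same_type L M (map g bs) W bs"
    using same_type_sym[OF elementary_map_same_type[OF W(1) g bs]] .
  moreover have "set (map g bs) \<subseteq> carrier M" using bs g by (auto simp: elementary_map_def)
  ultimately show ?thesis using M bs True matching_infinite[OF M(2)] by blast
qed

lemma bisimulation_matching: "bisimulation L \<M> collapsed matching"
  unfolding bisimulation_def
proof (intro conjI allI impI)
  obtain M where "M \<in> worlds \<M>" using infinite_world by blast
  then show "matching \<noteq> {}" using matching_left_total[of M "[]"] by auto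
  show "matching \<subseteq> pairs \<M> \<times> pairs collapsed"
    by (auto simp: matching_def pairs_def worlds_collapsed split: if_splits)
next
  fix M as N bs
  assume *: "((M, as), (N, bs)) \<in> matching"
  show "length as = length bs" "partial_isomorphism L M as N bs"
    using * same_type_partial_isomorphism[of L M as W bs]
    by (auto simp: matching_def same_type_def partial_isomorphism_def split: if_splits)
  show "\<forall>c\<in>carrier M. \<exists>d\<in>carrier N. ((M, as @ [c]), (N, bs @ [d])) \<in> matching"
    "\<forall>d\<in>carrier N. \<exists>c\<in>carrier M. ((M, as @ [c]), (N, bs @ [d])) \<in> matching"
  proof (atomize (full), cases "finite (carrier M)")
    case True
    then show "(\<forall>c\<in>carrier M. \<exists>d\<in>carrier N. ((M, as @ [c]), (N, bs @ [d])) \<in> matching) \<and>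
      (\<forall>d\<in>carrier N. \<exists>c\<in>carrier M. ((M, as @ [c]), (N, bs @ [d])) \<in> matching)"
      using * by (auto simp: matching_finite)
  next
    case False
    then have "M \<in> worlds \<M>" "set as \<subseteq> carrier M" "N = W" "set bs \<subseteq> carrier W" "same_type L M as W bs"
      using * by (simp_all add: matching_infinite)
    then show "(\<forall>c\<in>carrier M. \<exists>d\<in>carrier N. ((M, as @ [c]), (N, bs @ [d])) \<in> matching) \<and>
      (\<forall>d\<in>carrier N. \<exists>c\<in>carrier M. ((M, as @ [c]), (N, bs @ [d])) \<in> matching)"
      using same_type_extend[of M as bs] False by (simp add: matching_infinite)
  qed
  have M: "M \<in> worlds \<M>" "set as \<subseteq> carrier M" using * by (auto simp: matching_def)
  have map_in: "set (map \<pi> as) \<subseteq> carrier M'" if "(M, \<pi>, M') \<in> embs \<M>" for \<pi> M'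
    using M(2) embedding_in_carrier[OF embs_world(3)[OF that]] by auto
  show "\<exists>\<rho> N'. (N, \<rho>, N') \<in> embs collapsed \<and> ((M', map \<pi> as), (N', map \<rho> bs)) \<in> matching"
    if \<pi>: "(M, \<pi>, M') \<in> embs \<M>" for \<pi> M'
  proof (cases "finite (carrier M')")
    case True
    then have "finite (carrier M)" using embs_finite[OF \<pi>] by simp
    then have "N = M" "bs = as" using * by (simp_all add: matching_finite)
    then show ?thesis
      using True \<pi> embs_world(2)[OF \<pi>] map_in[OF \<pi>] matching_finite[OF True] embs_collapsed by blast
  next
    case inf: False
    show ?thesis
    proof (cases "finite (carrier M)")
      case True
      then have eq: "N = M" "bs = as" using * by (simp_all add: matching_finite)
      obtain \<rho> where \<rho>: "into_W M \<rho>"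
        "\<And>xs. set xs \<subseteq> carrier M \<Longrightarrow> same_type L M' (map \<pi> xs) W (map \<rho> xs)"
        by (rule finite_world_into_W[OF \<pi> True inf]) (rule that)
      have "set (map \<rho> as) \<subseteq> carrier W"
        using M(2) \<rho>(1) embedding_in_carrier[of L M W \<rho>] by (auto simp: into_W_def)
      then have "((M', map \<pi> as), (W, map \<rho> bs)) \<in> matching"
        using matching_infinite[OF inf] embs_world(2)[OF \<pi>] map_in[OF \<pi>] \<rho>(2)[OF M(2)] eq by simp
      then show ?thesis using \<rho>(1) eq embs_collapsed by blast
    next
      case False
      then have N: "N = W" "set bs \<subseteq> carrier W" "same_type L M as W bs"
        using * by (simp_all add: matching_infinite)
      have "same_type L M as M' (map \<pi> as)"
        using elementary_map_same_type[OF worlds_structure[OF M(1)] elementary[OF \<pi> False] M(2)] .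
      then have "same_type L M' (map \<pi> as) W bs"
        using N(3) same_type_sym same_type_trans by metis
      moreover have "map (\<lambda>x\<in>carrier W. x) bs = bs"
        using N(2) by (simp add: map_restrict_eq)
      ultimately have "((M', map \<pi> as), (W, map (\<lambda>x\<in>carrier W. x) bs)) \<in> matching"
        using matching_infinite[OF inf] embs_world(2)[OF \<pi>] map_in[OF \<pi>] N(2) by simp
      then show ?thesis using N(1) embs_collapsed by blast
    qed
  qed
  show "\<exists>\<pi> M'. (M, \<pi>, M') \<in> embs \<M> \<and> ((M', map \<pi> as), (N', map \<rho> bs)) \<in> matching"
    if \<rho>: "(N, \<rho>, N') \<in> embs collapsed" for \<rho> N'
  proof (cases "finite (carrier M)")
    case True
    then have eq: "N = M" "bs = as" using * by (simp_all add: matching_finite)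
    have "N \<noteq> W" using True eq(1) W(2) by blast
    then consider "(M, \<rho>, N') \<in> embs \<M>" "finite (carrier N')" | "N' = W" "into_W M \<rho>"
      using \<rho> eq(1) unfolding embs_collapsed by blast
    then show ?thesis
    proof cases
      case 1
      then show ?thesis
        using embs_world(2)[OF 1(1)] map_in[OF 1(1)] matching_finite[OF 1(2)] eq(2) by blast
    next
      case 2
      obtain \<pi> P where P: "(M, \<pi>, P) \<in> embs \<M>" "infinite (carrier P)"
        "same_type L P (map \<pi> as) W (map \<rho> as)"
        using 2(2) M(2) unfolding into_W_def by blast
      have "set (map \<rho> as) \<subseteq> carrier W"
        using M(2) 2(2) embedding_in_carrier[of L M W \<rho>] by (auto simp: into_W_def)
      then have "((P, map \<pi> as), (N', map \<rho> bs)) \<in> matching"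
        using matching_infinite[OF P(2)] embs_world(2)[OF P(1)] map_in[OF P(1)] P(3) eq(2) 2(1) by simp
      then show ?thesis using P(1) by blast
    qed
  next
    case False
    then have N: "N = W" "set bs \<subseteq> carrier W" using * by (simp_all add: matching_infinite)
    have "N' = W \<and> \<rho> = (\<lambda>x\<in>carrier W. x)"
      using \<rho> N(1) W(2) embs_finite[of W \<rho> N'] unfolding embs_collapsed into_W_def by blast
    moreover have "map (\<lambda>x\<in>carrier W. x) bs = bs" "map (\<lambda>x\<in>carrier M. x) as = as"
      using N(2) M(2) by (simp_all add: map_restrict_eq)
    ultimately have "((M, map (\<lambda>x\<in>carrier M. x) as), (N', map \<rho> bs)) \<in> matching"
      using * N(1) by simp
    then show ?thesis using embs_identity[OF M(1)] by blast
  qed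
qed

lemma bitotally_bisimilar_collapsed: "bitotally_bisimilar L \<M> collapsed"
  unfolding bitotally_bisimilar_def
proof (intro exI conjI ballI)
  show "bisimulation L \<M> collapsed matching" by (rule bisimulation_matching)
next
  fix p
  assume "p \<in> pairs \<M>"
  then show "\<exists>q\<in>pairs collapsed. (p, q) \<in> matching"
    using matching_left_total[of "fst p" "snd p"] by (fastforce simp: pairs_def)
next
  fix q
  assume "q \<in> pairs collapsed"
  then show "\<exists>p\<in>pairs \<M>. (p, q) \<in> matching"
    using matching_right_total[of "fst q" "snd q"] by (fastforce simp: pairs_def)
qed

lemma infinite_worlds_collapsed: "{N \<in> worlds collapsed. infinite (carrier N)} = {W}"
  using W(2) by (auto simp: worlds_collapsed)

lemma embs_W_collapsed:
  assumes "(W, \<pi>, W) \<in> embs collapsed"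
  shows "\<pi> = (\<lambda>x\<in>carrier W. x)"
  using assms W(2) by (auto simp: embs_collapsed into_W_def)

lemma collapsed_no_finite_worlds:
  assumes "\<And>M. M \<in> worlds \<M> \<Longrightarrow> infinite (carrier M)"
  shows "worlds collapsed = {W}" "embs collapsed = {(W, \<lambda>x\<in>carrier W. x, W)}"
proof -
  show "worlds collapsed = {W}" using assms by (auto simp: worlds_collapsed)
  have "\<not> finite (carrier M')" if "(M, \<pi>, M') \<in> embs \<M>" for M \<pi> M'
    using assms embs_world(2)[OF that] by blast
  moreover have "\<not> into_W F \<rho>" for F \<rho> using assms by (auto simp: into_W_def)
  ultimately show "embs collapsed = {(W, \<lambda>x\<in>carrier W. x, W)}"
    by (auto simp: embs_collapsed)
qed

end

theorem theorem56:
  fixes L :: "('f, 'r) language"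
    and \<M> :: "('f, 'r, 'a) system"
    and T :: "('f, 'r) fm set"
  assumes "countable_language L"
    and "potentialist_system L \<M>"
    and "\<exists>M\<in>worlds \<M>. infinite (carrier M)"
    and "T = theory_of L \<M>"
    and "aleph0_categorical L T"
    and "has_qe L T"
  shows "(\<exists>\<N> :: ('f, 'r, 'a) system.
            potentialist_system L \<N> \<and> bitotally_bisimilar L \<M> \<N> \<and>
            (\<exists>W. {N \<in> worlds \<N>. infinite (carrier N)} = {W} \<and>
                 countable (carrier W) \<and>
                 (\<forall>\<pi>. (W, \<pi>, W) \<in> embs \<N> \<longrightarrow> \<pi> = (\<lambda>x\<in>carrier W. x)))) \<and>
         (no_finite_models L T \<longrightarrow>
            (\<exists>(\<N> :: ('f, 'r, 'a) system) W.
               potentialist_system L \<N> \<and> bitotally_bisimilar L \<M> \<N> \<and>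
               worlds \<N> = {W} \<and> countable (carrier W) \<and>
               embs \<N> = {(W, \<lambda>x\<in>carrier W. x, W)}))"
proof -
  note L = assms(1) and cat = assms(5) and qe = assms(6)
  have wf: "\<forall>\<phi>\<in>T. wf_fm L \<phi>" using assms(4) by (simp add: theory_of_def)
  have world: "is_model L T M" if "M \<in> worlds \<M>" for M
    using that assms(2,4) by (simp add: is_model_def theory_of_def potentialist_system_def)
  obtain M where M: "M \<in> worlds \<M>" "infinite (carrier M)" using assms(3) by blast
  obtain A where A: "countable A" "infinite A" "A \<subseteq> carrier M"
    using infinite_countable_subset'[OF M(2)] by blast
  have st: "is_structure L M" using world[OF M(1)] by (simp add: is_model_def)
  note LS = elementary_substructure_closed_under[where H = "\<lambda>_. {}", OF L st A(1,3)]
  obtain B where B: "countable B" "A \<subseteq> B" "is_structure L (substructure L M B)"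
    "elementary_map L (substructure L M B) M (\<lambda>x\<in>B. x)"
    by (rule LS) (simp, rule that)
  define W where "W = substructure L M B"
  have model: "is_model L T W" "infinite (carrier W)" "countable (carrier W)"
    using is_model_elementary_substructure[OF world[OF M(1)] wf B(3,4)] A(2) B(1,2)
    by (auto simp: W_def dest: finite_subset)
  interpret collapse L \<M> W
  proof unfold_locales
    show "is_structure L W" using B(3) by (simp add: W_def)
    show "homogeneous L W" by (rule categorical_homogeneous[OF L cat wf model])
  next
    fix M A
    assume "M \<in> worlds \<M>" "infinite (carrier M)" "finite A" "A \<subseteq> carrier M"
    then show "\<exists>g. is_embedding L W M g \<and> elementary_map L W M g \<and> A \<subseteq> g ` carrier W"
      using countable_elementary_cover[OF L cat wf model world] countable_finite by metis
  next
    fix M \<pi> M'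
    assume *: "(M, \<pi>, M') \<in> embs \<M>" "infinite (carrier M)"
    then have emb: "M \<in> worlds \<M>" "M' \<in> worlds \<M>" "is_embedding L M M' \<pi>"
      using assms(2) unfolding potentialist_system_def by blast+
    then have "infinite (carrier M')"
      using *(2) embedding_finite by blast
    then show "elementary_map L M M' \<pi>"
      using embedding_elementary_map[OF L cat wf qe world[OF emb(1)] *(2) world[OF emb(2)] _ emb(3)] by blast
  qed (use assms(2,3) model(2) in auto)
  \<comment> \<open>The absence of finite models concerns carriers of natural numbers, so a finite world is
    copied there.\<close>
  have infinite_worlds: "infinite (carrier F)" if "no_finite_models L T" "F \<in> worlds \<M>" for F
  proof
    assume fin: "finite (carrier F)"
    then have inj: "inj_on (to_nat_on (carrier F)) (carrier F)"
      by (intro inj_on_to_nat_on countable_finite)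
    have F: "is_structure L F" using worlds_structure[OF that(2)] .
    have "is_model L T (copy L F (to_nat_on (carrier F)))"
      using isomorphic_is_model[OF world[OF that(2)] is_structure_copy[OF F] isomorphic_copy[OF F inj] wf] .
    then have "infinite (carrier (copy L F (to_nat_on (carrier F))))"
      using that(1) unfolding no_finite_models_def by blast
    then show False using fin by (simp add: copy_def)
  qed
  note collapsed = potentialist_system_collapsed bitotally_bisimilar_collapsed
  show ?thesis
  proof (rule conjI)
    have "\<forall>\<pi>. (W, \<pi>, W) \<in> embs collapsed \<longrightarrow> \<pi> = (\<lambda>x\<in>carrier W. x)"
      by (intro allI impI) (rule embs_W_collapsed)
    then have "\<exists>W. {N \<in> worlds collapsed. infinite (carrier N)} = {W} \<and> countable (carrier W) \<and>
        (\<forall>\<pi>. (W, \<pi>, W) \<in> embs collapsed \<longrightarrow> \<pi> = (\<lambda>x\<in>carrier W. x))"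
      by (intro exI[of _ W] conjI infinite_worlds_collapsed model(3))
    then show "\<exists>\<N> :: ('f, 'r, 'a) system.
        potentialist_system L \<N> \<and> bitotally_bisimilar L \<M> \<N> \<and>
        (\<exists>W. {N \<in> worlds \<N>. infinite (carrier N)} = {W} \<and> countable (carrier W) \<and>
          (\<forall>\<pi>. (W, \<pi>, W) \<in> embs \<N> \<longrightarrow> \<pi> = (\<lambda>x\<in>carrier W. x)))"
      by (intro exI[of _ collapsed] conjI collapsed)
    show "no_finite_models L T \<longrightarrow>
      (\<exists>(\<N> :: ('f, 'r, 'a) system) W.
         potentialist_system L \<N> \<and> bitotally_bisimilar L \<M> \<N> \<and>
         worlds \<N> = {W} \<and> countable (carrier W) \<and>
         embs \<N> = {(W, \<lambda>x\<in>carrier W. x, W)})"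
    proof
      assume "no_finite_models L T"
      note single = collapsed_no_finite_worlds[OF infinite_worlds[OF this]]
      show "\<exists>(\<N> :: ('f, 'r, 'a) system) W.
         potentialist_system L \<N> \<and> bitotally_bisimilar L \<M> \<N> \<and>
         worlds \<N> = {W} \<and> countable (carrier W) \<and>
         embs \<N> = {(W, \<lambda>x\<in>carrier W. x, W)}"
        by (intro exI[of _ collapsed] exI[of _ W] conjI collapsed single model(3))
    qed
  qed
qed

end
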